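(* Let $A$ be a finite set with $q:=|A|\ge 2$ and let $n\ge 2$. For $2\le l\le n$ let $G_l$ be the subgroup of $\mathrm{Sym}(A^n)$ generated by all $l$-ary instructions. Then: (i) for any $n$, $G_n=\mathrm{Sym}(A^n)$; (ii) if $q=2$ (identifying $A$ with $\mathrm{GF}(2)$), then $G_2=\mathrm{Aff}(n,2)$ for all $n$, and $G_3=G_{n-1}=\mathrm{Alt}(A^n)$ for $n\ge 4$; (iii) if $n\ge 3$ and $q\ge 3$ is odd, then $G_2=G_{n-1}=\mathrm{Sym}(A^n)$; (iv) if $n\ge 3$ and $q\ge 4$ is even, then $G_2=G_{n-1}=\mathrm{Alt}(A^n)$.
   Context: Any $f\in\mathrm{Sym}(A^n)$ is written $f(x)=(f_1(x),\ldots,f_n(x))$ with coordinate functions $f_i:A^n\to A$; the $i$-th coordinate function is trivial if $f_i(x)=x_i$ for all $x$. An instruction is a permutation of $A^n$ with at most one nontrivial coordinate function (the identity counts as an instruction). A coordinate function $f_j$ is $l$-ary if it depends on at most $l$ of the variables, i.e. $f_j(x)=h(x_{k_1},\ldots,x_{k_l})$ for some $k_1,\ldots,k_l\in\{1,\ldots,n\}$ and some $h:A^l\to A$; an $l$-ary instruction is an instruction whose coordinate functions are all $l$-ary. $\mathrm{Aff}(n,2)$ denotes the affine group of $\mathrm{GF}(2)^n$ (maps $x\mapsto Mx+b$ with $M\in\mathrm{GL}(n,2)$, $b\in\mathrm{GF}(2)^n$). *)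

theory Defs
  imports "HOL-Combinatorics.Permutations" "HOL-Library.Z2"
begin

definition cube :: "'a set \<Rightarrow> nat \<Rightarrow> 'a list set" where
  "cube A n = {xs. length xs = n \<and> set xs \<subseteq> A}"

definition SymC :: "'a set \<Rightarrow> nat \<Rightarrow> ('a list \<Rightarrow> 'a list) set" where
  "SymC A n = {f. f permutes cube A n}"

definition AltC :: "'a set \<Rightarrow> nat \<Rightarrow> ('a list \<Rightarrow> 'a list) set" where
  "AltC A n = {f. f permutes cube A n \<and> evenperm f}"

definition is_instruction :: "'a set \<Rightarrow> nat \<Rightarrow> ('a list \<Rightarrow> 'a list) \<Rightarrow> bool" where
  "is_instruction A n f \<longleftrightarrow> f permutes cube A n \<and>
     (\<exists>i<n. \<forall>x\<in>cube A n. \<forall>j<n. j \<noteq> i \<longrightarrow> f x ! j = x ! j)"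

definition coord_lary :: "'a set \<Rightarrow> nat \<Rightarrow> nat \<Rightarrow> ('a list \<Rightarrow> 'a list) \<Rightarrow> nat \<Rightarrow> bool" where
  "coord_lary A n l f j \<longleftrightarrow>
     (\<exists>ks h. length ks = l \<and> set ks \<subseteq> {..<n} \<and>
        (\<forall>x\<in>cube A n. f x ! j = h (map (\<lambda>k. x ! k) ks)))"

definition lary_instruction :: "'a set \<Rightarrow> nat \<Rightarrow> nat \<Rightarrow> ('a list \<Rightarrow> 'a list) \<Rightarrow> bool" where
  "lary_instruction A n l f \<longleftrightarrow> is_instruction A n f \<and> (\<forall>j<n. coord_lary A n l f j)"

inductive_set gen_perm_group :: "('b \<Rightarrow> 'b) set \<Rightarrow> ('b \<Rightarrow> 'b) set" for S where
  gen_id: "id \<in> gen_perm_group S"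
| gen_incl: "f \<in> S \<Longrightarrow> f \<in> gen_perm_group S"
| gen_comp: "f \<in> gen_perm_group S \<Longrightarrow> g \<in> gen_perm_group S \<Longrightarrow> f \<circ> g \<in> gen_perm_group S"
| gen_inv: "f \<in> gen_perm_group S \<Longrightarrow> inv f \<in> gen_perm_group S"

definition G :: "'a set \<Rightarrow> nat \<Rightarrow> nat \<Rightarrow> ('a list \<Rightarrow> 'a list) set" where
  "G A n l = gen_perm_group {f. lary_instruction A n l f}"

text \<open>Aff(n,2), transported to A^n via the identification a0 \<mapsto> 0, a1 \<mapsto> 1 of A = {a0,a1}
  with GF(2) (type bit). Matrices are nat \<Rightarrow> nat \<Rightarrow> bit with indices < n.\<close>
definition enc2 :: "'a \<Rightarrow> 'a \<Rightarrow> bit" where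
  "enc2 a1 a = (if a = a1 then 1 else 0)"

definition dec2 :: "'a \<Rightarrow> 'a \<Rightarrow> bit \<Rightarrow> 'a" where
  "dec2 a0 a1 b = (if b = 1 then a1 else a0)"

definition invertible2 :: "nat \<Rightarrow> (nat \<Rightarrow> nat \<Rightarrow> bit) \<Rightarrow> bool" where
  "invertible2 n M \<longleftrightarrow> (\<exists>N. \<forall>i<n. \<forall>k<n.
      (\<Sum>j<n. N i j * M j k) = (if i = k then 1 else 0))"

definition AffC :: "'a \<Rightarrow> 'a \<Rightarrow> nat \<Rightarrow> ('a list \<Rightarrow> 'a list) set" where
  "AffC a0 a1 n = {f. f permutes cube {a0, a1} n \<and>
     (\<exists>M b. invertible2 n M \<and>
        (\<forall>x\<in>cube {a0, a1} n. f x =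
           map (\<lambda>i. dec2 a0 a1 ((\<Sum>j<n. M i j * enc2 a1 (x ! j)) + b i)) [0..<n]))}"

end

theory Submission
  imports Defs "HOL-Combinatorics.Cycles"
begin

text \<open>
  A subgroup of the symmetric group of a finite set contains the alternating group as soon as any
  two points lie in a common three-cycle of the subgroup, and this relation between points is
  transitive. On the cube it therefore suffices to treat points differing in one coordinate.

  An instruction on the coordinate \<open>i\<close> is a family of permutations of the alphabet indexed by the
  other coordinates, and such families are composed pointwise. For \<open>q \<ge> 3\<close> a three-cycle is the
  commutator of a transposition and itself, so commutators of controlled instructions add one
  control at a time and turn binary instructions into a three-cycle of points on a line. For
  \<open>q = 2\<close> commutators of toggles on different coordinates yield products of two transpositions;
  two of these having a single moved point in common have a three-cycle as commutator.

  An instruction ignoring the coordinate \<open>k\<close> is the product of \<open>q\<close> conjugate pieces, one for each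
  value of that coordinate. For even \<open>q\<close> it is therefore even; for odd \<open>q\<close> adding a control does
  not change the parity, so a transposition acting on one coordinate is odd like a transposition
  of points. Over \<open>GF(2)\<close> a permutation is affine iff it preserves \<open>x + y + z\<close>, which binary
  instructions do, and Gaussian elimination provides the converse inclusion.
\<close>

section \<open>Three-cycles and commutators\<close>

definition three_cycle :: "'b \<Rightarrow> 'b \<Rightarrow> 'b \<Rightarrow> 'b \<Rightarrow> 'b" where
  "three_cycle x y z = cycle_of_list [x, y, z]"

lemma three_cycle_eq_transpositions: "three_cycle x y z = transpose x y \<circ> transpose y z"
  by (simp add: three_cycle_def)

lemma three_cycle_apply:
  assumes "distinct [x, y, z]"
  shows "three_cycle x y z u = (if u = x then y else if u = y then z else if u = z then x else u)"
  using assms by (auto simp: three_cycle_eq_transpositions transpose_def)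

lemma three_cycle_permutes: "{x, y, z} \<subseteq> A \<Longrightarrow> three_cycle x y z permutes A"
  using permutes_subset[OF cycle_permutes[of "[x, y, z]"]] by (simp add: three_cycle_def)

lemma three_cycle_rotate: "distinct [x, y, z] \<Longrightarrow> three_cycle y z x = three_cycle x y z"
  using cycle_of_list_rotate_independent[of "[x, y, z]" 1]
  by (simp add: three_cycle_def del: cycle_of_list.simps)

lemma inv_three_cycle: "inv (three_cycle x y z) = three_cycle z y x"
  by (rule inv_unique_comp)
    (simp_all add: three_cycle_eq_transpositions fun_eq_iff transpose_commute)

lemma three_cycle_conj:
  assumes "distinct [x, y, z]" "bij g"
  shows "g \<circ> three_cycle x y z \<circ> inv g = three_cycle (g x) (g y) (g z)"
  using conjugation_of_cycle[OF assms] by (simp only: three_cycle_def list.map)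

lemma commutator_transpose_three_cycle:
  assumes "distinct [a, b, c]"
  shows "transpose a b \<circ> three_cycle a b c \<circ> inv (transpose a b) \<circ> inv (three_cycle a b c)
    = three_cycle a b c"
proof -
  have "transpose a b \<circ> three_cycle a b c \<circ> inv (transpose a b) = three_cycle b a c"
    using three_cycle_conj[OF assms, of "transpose a b"] assms by auto
  moreover have "three_cycle b a c \<circ> three_cycle c b a = three_cycle a b c"
    using assms by (auto simp: fun_eq_iff three_cycle_apply)
  ultimately show ?thesis
    by (simp only: inv_three_cycle)
qed

context
  fixes f g :: "'b \<Rightarrow> 'b" and a :: 'b
  assumes bij_f: "bij f" and bij_g: "bij g"
    and common_moved_point: "\<And>x. f x \<noteq> x \<and> g x \<noteq> x \<longleftrightarrow> x = a"
begin

lemmas images_eq_iff = inj_eq[OF bij_is_inj[OF bij_f]] inj_eq[OF bij_is_inj[OF bij_g]]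

lemma fixes_image_of_common_moved_point: "g (f a) = f a" "f (g a) = g a"
  using common_moved_point[of a] common_moved_point[of "f a"] common_moved_point[of "g a"]
  by (auto simp: images_eq_iff)

lemma distinct_images_of_common_moved_point: "distinct [a, f a, g a]"
  using common_moved_point[of a] fixes_image_of_common_moved_point by (auto simp: images_eq_iff)

lemma commute_up_to_three_cycle: "f (g w) = three_cycle a (f a) (g a) (g (f w))"
proof -
  note cycle = three_cycle_apply[OF distinct_images_of_common_moved_point]
  consider "w = a" | "f w = a" "w \<noteq> a" | "g w = a" "w \<noteq> a" | "w \<noteq> a" "f w \<noteq> a" "g w \<noteq> a"
    by blast
  then show ?thesis
  proof cases
    assume "w = a"
    then show ?thesis
      using fixes_image_of_common_moved_point distinct_images_of_common_moved_point
      by (auto simp: cycle)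
  next
    assume "f w = a" "w \<noteq> a"
    moreover from this have "g w = w"
      using common_moved_point[of w] by auto
    ultimately show ?thesis
      using distinct_images_of_common_moved_point by (auto simp: cycle)
  next
    assume "g w = a" "w \<noteq> a"
    moreover from this have "f w = w"
      using common_moved_point[of w] by auto
    ultimately show ?thesis
      by (simp add: cycle)
  next
    assume not_a: "w \<noteq> a" "f w \<noteq> a" "g w \<noteq> a"
    then have commute: "f (g w) = g (f w)"
      using common_moved_point[of w] common_moved_point[of "f w"] common_moved_point[of "g w"]
      by (metis images_eq_iff)
    have "g (f w) \<noteq> a"
      using commute common_moved_point[of w] not_a by metis
    moreover have "g (f w) \<noteq> f a"
      using not_a fixes_image_of_common_moved_point by (metis images_eq_iff(1) commute)
    moreover have "g (f w) \<noteq> g a"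
      using not_a by (simp add: images_eq_iff)
    ultimately show ?thesis
      using commute by (simp add: cycle)
  qed
qed

lemma commutator_eq_three_cycle: "f \<circ> g \<circ> inv f \<circ> inv g = three_cycle a (f a) (g a)"
proof
  fix u
  have "f (inv f v) = v" "g (inv g v) = v" for v
    using bij_f bij_g by (simp_all add: bij_is_surj surj_f_inv_f)
  then show "(f \<circ> g \<circ> inv f \<circ> inv g) u = three_cycle a (f a) (g a) u"
    by (simp add: commute_up_to_three_cycle)
qed

end

section \<open>Groups of permutations of a finite set\<close>

locale perm_group =
  fixes X :: "'b set" and H :: "('b \<Rightarrow> 'b) set"
  assumes finite_X: "finite X"
    and permutes: "f \<in> H \<Longrightarrow> f permutes X"
    and id_mem: "id \<in> H"
    and comp_mem: "f \<in> H \<Longrightarrow> g \<in> H \<Longrightarrow> f \<circ> g \<in> H"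
    and inv_mem: "f \<in> H \<Longrightarrow> inv f \<in> H"
begin

lemma bij: "f \<in> H \<Longrightarrow> bij f"
  using permutes permutes_bij by blast

lemma mem_X_iff: "f \<in> H \<Longrightarrow> f x \<in> X \<longleftrightarrow> x \<in> X"
  using permutes_in_image[OF permutes] by simp

lemma permutation_mem: "f \<in> H \<Longrightarrow> permutation f"
  using permutes permutes_imp_permutation[OF finite_X] by blast

lemma conj_mem: "f \<in> H \<Longrightarrow> g \<in> H \<Longrightarrow> g \<circ> f \<circ> inv g \<in> H"
  by (simp add: comp_mem inv_mem)

lemma commutator_mem: "f \<in> H \<Longrightarrow> g \<in> H \<Longrightarrow> f \<circ> g \<circ> inv f \<circ> inv g \<in> H"
  by (simp add: comp_mem inv_mem)

lemma three_cycle_conj_mem: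
  assumes "three_cycle x y z \<in> H" "distinct [x, y, z]" "g \<in> H"
  shows "three_cycle (g x) (g y) (g z) \<in> H"
  using conj_mem[OF assms(1,3)] three_cycle_conj[OF assms(2) bij[OF assms(3)]] by simp

lemma three_cycle_inv_mem: "three_cycle x y z \<in> H \<Longrightarrow> three_cycle z y x \<in> H"
  using inv_mem inv_three_cycle by metis

lemma three_cycle_rotate_mem:
  "three_cycle x y z \<in> H \<Longrightarrow> distinct [x, y, z] \<Longrightarrow> three_cycle y z x \<in> H"
  by (simp add: three_cycle_rotate)

definition linked :: "'b \<Rightarrow> 'b \<Rightarrow> bool" where
  "linked x y \<longleftrightarrow> x = y \<or> (\<exists>z. distinct [x, y, z] \<and> three_cycle x y z \<in> H)"

lemma linkedE:
  assumes "linked x y" "x \<noteq> y"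
  obtains z where "distinct [x, y, z]" "three_cycle x y z \<in> H"
  using assms by (auto simp: linked_def)

lemma three_cycle_mem_replace_last:
  assumes "three_cycle x y u \<in> H" "distinct [x, y, u]" "distinct [x, y, z]" "linked u z"
  shows "three_cycle x y z \<in> H"
proof (cases "u = z")
  case True
  then show ?thesis
    using assms(1) by simp
next
  case False
  with assms(4) obtain v where v: "distinct [u, z, v]" "three_cycle u z v \<in> H"
    by (rule linkedE)
  let ?g = "three_cycle u z v" and ?h = "three_cycle v z u"
  have h: "distinct [v, z, u]" "?h \<in> H"
    using v three_cycle_inv_mem by auto
  consider "v \<noteq> x" "v \<noteq> y" | "v = x" | "v = y"
    by blast
  then show ?thesis
  proof cases
    assume "v \<noteq> x" "v \<noteq> y"
    then have "?g x = x" "?g y = y" "?g u = z"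
      using assms(2,3) v(1) by (auto simp: three_cycle_apply)
    then show ?thesis
      using three_cycle_conj_mem[OF assms(1,2) v(2)] by simp
  next
    assume "v = x"
    then have "?h x = z" "?h y = y" "?h u = x"
      using assms(2,3) h(1) by (auto simp: three_cycle_apply)
    then show ?thesis
      using three_cycle_conj_mem[OF assms(1,2) h(2)] three_cycle_inv_mem by metis
  next
    assume "v = y"
    then have "?h x = x" "?h y = z" "?h u = y"
      using assms(2,3) h(1) by (auto simp: three_cycle_apply)
    then have "three_cycle y z x \<in> H"
      using three_cycle_conj_mem[OF assms(1,2) h(2)] three_cycle_inv_mem by metis
    then show ?thesis
      using three_cycle_rotate assms(3) by metis
  qed
qed

lemma reflp_linked: "reflp linked"
  by (simp add: reflp_def linked_def)

lemma transp_linked: "transp linked"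
proof (rule transpI)
  fix x y w
  assume xy: "linked x y" and yw: "linked y w"
  show "linked x w"
  proof (cases "x = y \<or> y = w \<or> x = w")
    case True
    then show ?thesis
      using xy yw by (auto simp: linked_def)
  next
    case False
    then obtain z where z: "distinct [x, y, z]" "three_cycle x y z \<in> H"
      using linkedE[OF xy] by blast
    have "three_cycle x w (if z = w then y else z) \<in> H"
    proof (cases "z = w")
      case True
      then show ?thesis
        using z three_cycle_inv_mem[OF z(2)] three_cycle_rotate[of x w y] False by auto
    next
      case z_w: False
      have "three_cycle z x y \<in> H"
        using z three_cycle_rotate[of z x y] by auto
      then have "three_cycle z x w \<in> H"
        using z z_w False yw by (intro three_cycle_mem_replace_last[of z x y w]) auto
      then show ?thesis
        using z z_w False three_cycle_rotate_mem[of z x w] by auto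
    qed
    then show ?thesis
      using False z(1) unfolding linked_def
      by (intro disjI2 exI[of _ "if z = w then y else z"]) auto
  qed
qed

lemma three_cycle_mem_if_linked:
  assumes linked: "\<And>x y. x \<in> X \<Longrightarrow> y \<in> X \<Longrightarrow> linked x y"
    and "x \<in> X" "y \<in> X" "z \<in> X" "distinct [x, y, z]"
  shows "three_cycle x y z \<in> H"
proof -
  obtain u where u: "distinct [x, y, u]" "three_cycle x y u \<in> H"
    using linkedE[OF linked[of x y]] assms by auto
  have "u \<in> X"
    using mem_X_iff[OF u(2), of y] u(1) \<open>y \<in> X\<close> by (auto simp: three_cycle_apply)
  then show ?thesis
    using u assms by (intro three_cycle_mem_replace_last[of x y u z]) auto
qed

lemma transpose_transpose_mem_if_linked:
  assumes linked: "\<And>x y. x \<in> X \<Longrightarrow> y \<in> X \<Longrightarrow> linked x y"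
    and "a \<in> X" "b \<in> X" "c \<in> X" "d \<in> X" and "a \<noteq> b" "c \<noteq> d"
  shows "transpose a b \<circ> transpose c d \<in> H"
proof -
  have common_point: "transpose x y \<circ> transpose y z \<in> H"
    if "x \<in> X" "y \<in> X" "z \<in> X" "x \<noteq> y" "y \<noteq> z" for x y z
  proof (cases "x = z")
    case True
    then show ?thesis
      using id_mem by (simp add: transpose_commute[of z y])
  next
    case False
    then show ?thesis
      using three_cycle_mem_if_linked[OF linked, of x y z] that
      by (simp add: three_cycle_eq_transpositions)
  qed
  show ?thesis
  proof (cases "b = c")
    case True
    then show ?thesis
      using common_point[of a b d] assms by simp
  next
    case False
    have "(transpose a b \<circ> transpose b c) \<circ> (transpose b c \<circ> transpose c d) \<in> H"
      using comp_mem common_point[of a b c] common_point[of b c d] assms False by simp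
    then show ?thesis
      by (simp add: comp_def)
  qed
qed

theorem even_mem_if_linked:
  assumes linked: "\<And>x y. x \<in> X \<Longrightarrow> y \<in> X \<Longrightarrow> linked x y"
    and p: "p permutes X" "evenperm p"
  shows "p \<in> H"
proof -
  have "if evenperm p then p \<in> H else \<forall>a\<in>X. \<forall>b\<in>X. a \<noteq> b \<longrightarrow> transpose a b \<circ> p \<in> H"
    using p(1) finite_X
  proof (induction rule: permutes_induct)
    case id
    then show ?case
      using id_mem by simp
  next
    case (swap c d p)
    have parity: "evenperm (transpose c d \<circ> p) \<longleftrightarrow> \<not> evenperm p"
      using swap permutes_imp_permutation[OF finite_X]
      by (simp add: evenperm_comp permutation_swap_id evenperm_swap)
    show ?case
    proof (cases "evenperm p")
      case True
      have "transpose a b \<circ> (transpose c d \<circ> p) \<in> H" if "a \<in> X" "b \<in> X" "a \<noteq> b" for a b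
        using swap True that comp_mem[OF transpose_transpose_mem_if_linked[OF linked, of a b c d]]
        by (simp flip: comp_assoc)
      then show ?thesis
        using parity True by metis
    next
      case False
      then show ?thesis
        using swap parity by metis
    qed
  qed
  then show ?thesis
    using p(2) by simp
qed

theorem all_mem_if_linked_and_odd:
  assumes linked: "\<And>x y. x \<in> X \<Longrightarrow> y \<in> X \<Longrightarrow> linked x y"
    and g: "g \<in> H" "\<not> evenperm g" and p: "p permutes X"
  shows "p \<in> H"
proof (cases "evenperm p")
  case True
  then show ?thesis
    using even_mem_if_linked linked p by blast
next
  case False
  have "evenperm (p \<circ> inv g)"
    using False g(2) permutes_imp_permutation[OF finite_X p] permutation_mem[OF g(1)]
    by (simp add: evenperm_comp evenperm_inv permutation_inverse)
  moreover have "p \<circ> inv g permutes X"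
    using permutes[OF inv_mem[OF g(1)]] p by (rule permutes_compose)
  ultimately have "p \<circ> inv g \<circ> g \<in> H"
    using even_mem_if_linked linked g(1) by (blast intro: comp_mem)
  then show ?thesis
    using bij[OF g(1)] by (simp add: comp_assoc bij_is_inj)
qed

lemma reflp_transpose_mem: "reflp (\<lambda>x y. transpose x y \<in> H)"
  using id_mem by (simp add: reflp_def)

lemma transp_transpose_mem: "transp (\<lambda>x y. transpose x y \<in> H)"
proof (rule transpI)
  fix x y z
  assume xy: "transpose x y \<in> H" and yz: "transpose y z \<in> H"
  show "transpose x z \<in> H"
  proof (cases "x = z \<or> y = z")
    case True
    then show ?thesis
      using xy id_mem by auto
  next
    case False
    then show ?thesis
      using comp_mem[OF comp_mem[OF xy yz] xy] transpose_comp_triple[of x z y] by metis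
  qed
qed

theorem all_mem_if_transpositions:
  assumes transp: "\<And>x y. x \<in> X \<Longrightarrow> y \<in> X \<Longrightarrow> transpose x y \<in> H"
    and p: "p permutes X"
  shows "p \<in> H"
  using p finite_X
  by (induction rule: permutes_induct) (blast intro: id_mem comp_mem transp)+

definition same_orbit :: "'b \<Rightarrow> 'b \<Rightarrow> bool" where
  "same_orbit x y \<longleftrightarrow> (\<exists>h\<in>H. h x = y)"

lemma reflp_same_orbit: "reflp same_orbit"
  unfolding reflp_def same_orbit_def using id_mem by (metis id_apply)

lemma transp_same_orbit: "transp same_orbit"
  unfolding transp_def same_orbit_def using comp_mem by (metis comp_apply)

definition pointwise_stabilizer :: "'b set \<Rightarrow> ('b \<Rightarrow> 'b) set" where
  "pointwise_stabilizer S = {h \<in> H. \<forall>x\<in>S. h x = x}"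

lemma perm_group_pointwise_stabilizer: "perm_group X (pointwise_stabilizer S)"
proof
  show "inv h \<in> pointwise_stabilizer S" if "h \<in> pointwise_stabilizer S" for h
    using that inv_mem by (auto simp: pointwise_stabilizer_def bij bij_is_inj intro: inv_f_eq)
qed (auto simp: pointwise_stabilizer_def finite_X permutes id_mem comp_mem)

end

lemma gen_perm_group_subset:
  assumes "perm_group X H" "S \<subseteq> H"
  shows "gen_perm_group S \<subseteq> H"
proof
  interpret perm_group X H
    by fact
  show "f \<in> H" if "f \<in> gen_perm_group S" for f
    using that assms(2) by induction (blast intro: id_mem comp_mem inv_mem)+
qed

lemma gen_perm_group_mono:
  assumes "S \<subseteq> T"
  shows "gen_perm_group S \<subseteq> gen_perm_group T"
proof
  show "f \<in> gen_perm_group T" if "f \<in> gen_perm_group S" for f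
    using that assms by induction (blast intro: gen_perm_group.intros)+
qed

lemma perm_group_gen_perm_group:
  assumes "finite X" "\<And>f. f \<in> S \<Longrightarrow> f permutes X"
  shows "perm_group X (gen_perm_group S)"
proof
  show "f permutes X" if "f \<in> gen_perm_group S" for f
    using that assms(2) by induction (blast intro: permutes_compose permutes_inv permutes_id)+
qed (auto intro: assms gen_perm_group.intros)

section \<open>Cubes\<close>

lemma finite_cube: "finite A \<Longrightarrow> finite (cube A n)"
  using finite_lists_length_eq[of A n] by (simp add: cube_def conj_commute)

lemma length_cube: "x \<in> cube A n \<Longrightarrow> length x = n"
  by (simp add: cube_def)

lemma nth_cube: "x \<in> cube A n \<Longrightarrow> i < n \<Longrightarrow> x ! i \<in> A"
  by (auto simp: cube_def)

lemma list_update_cube: "x \<in> cube A n \<Longrightarrow> a \<in> A \<Longrightarrow> x[i := a] \<in> cube A n"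
  using set_update_subset_insert[of x i a] by (auto simp: cube_def)

lemma replicate_cube: "a \<in> A \<Longrightarrow> replicate n a \<in> cube A n"
  by (auto simp: cube_def)

lemma cubeI: "length x = n \<Longrightarrow> (\<And>i. i < n \<Longrightarrow> x ! i \<in> A) \<Longrightarrow> x \<in> cube A n"
  by (auto simp: cube_def in_set_conv_nth)

lemma cube_eqI:
  "x \<in> cube A n \<Longrightarrow> y \<in> cube A n \<Longrightarrow> (\<And>i. i < n \<Longrightarrow> x ! i = y ! i) \<Longrightarrow> x = y"
  by (auto simp: cube_def intro: nth_equalityI)

lemma list_update_cube_eq_iff: "x \<in> cube A n \<Longrightarrow> i < n \<Longrightarrow> x[i := a] = x[i := b] \<longleftrightarrow> a = b"
  by (metis length_cube nth_list_update_eq)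

definition agree_on :: "nat set \<Rightarrow> 'a list \<Rightarrow> 'a list \<Rightarrow> bool" where
  "agree_on J x y \<longleftrightarrow> (\<forall>j\<in>J. x ! j = y ! j)"

lemma agree_on_list_update: "i \<notin> J \<Longrightarrow> agree_on J (x[i := a]) x"
  by (metis agree_on_def nth_list_update_neq)

lemma agree_on_off_coord_iff:
  assumes "x \<in> cube A n" "u \<in> cube A n" "i < n"
  shows "agree_on ({..<n} - {i}) x u \<longleftrightarrow> (\<exists>a\<in>A. u = x[i := a])"
proof
  assume agree: "agree_on ({..<n} - {i}) x u"
  have "u = x[i := u ! i]"
    using assms agree
    by (intro cube_eqI[of u A n])
      (auto simp: list_update_cube nth_cube nth_list_update length_cube agree_on_def)
  then show "\<exists>a\<in>A. u = x[i := a]"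
    using assms nth_cube by blast
qed (metis agree_on_def agree_on_list_update DiffE singletonI)

lemma cube_connected:
  assumes "reflp R" "transp R" and "x \<in> cube A n" "y \<in> cube A n"
    and step: "\<And>z i. z \<in> cube A n \<Longrightarrow> i < n \<Longrightarrow> z ! i \<noteq> y ! i \<Longrightarrow>
      (\<And>j. x ! j = y ! j \<Longrightarrow> z ! j = y ! j) \<Longrightarrow> R z (z[i := y ! i])"
  shows "R x y"
  using assms(3) step
proof (induction "card {i. i < n \<and> x ! i \<noteq> y ! i}" arbitrary: x rule: less_induct)
  case less
  show ?case
  proof (cases "\<exists>i<n. x ! i \<noteq> y ! i")
    case False
    then have "x = y"
      using less.prems(1) assms(4) by (intro cube_eqI) auto
    then show ?thesis
      using assms(1) by (simp add: reflpD)
  next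
    case True
    then obtain i where i: "i < n" "x ! i \<noteq> y ! i"
      by blast
    let ?x = "x[i := y ! i]"
    have nth: "?x ! j = (if j = i then y ! i else x ! j)" for j
      using i(1) less.prems(1) by (simp add: length_cube nth_list_update)
    have "{j. j < n \<and> ?x ! j \<noteq> y ! j} \<subset> {j. j < n \<and> x ! j \<noteq> y ! j}"
      using i by (auto simp: nth)
    then have "card {j. j < n \<and> ?x ! j \<noteq> y ! j} < card {j. j < n \<and> x ! j \<noteq> y ! j}"
      by (intro psubset_card_mono) auto
    moreover have "?x \<in> cube A n"
      using i(1) less.prems(1) assms(4) by (intro list_update_cube nth_cube)
    moreover have "R z (z[k := y ! k])"
      if "z \<in> cube A n" "k < n" "z ! k \<noteq> y ! k" "\<And>j. ?x ! j = y ! j \<Longrightarrow> z ! j = y ! j" for z k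
      using that by (intro less.prems(2)) (auto simp: nth)
    ultimately have "R ?x y"
      by (rule less.hyps)
    moreover have "R x ?x"
      using i less.prems(1) by (intro less.prems(2))
    ultimately show ?thesis
      using assms(2) transpD by metis
  qed
qed

definition depends_on :: "'a set \<Rightarrow> nat \<Rightarrow> nat set \<Rightarrow> ('a list \<Rightarrow> 'b) \<Rightarrow> bool" where
  "depends_on A n J f \<longleftrightarrow> (\<forall>x\<in>cube A n. \<forall>y\<in>cube A n. agree_on J x y \<longrightarrow> f x = f y)"

lemma depends_onD:
  "depends_on A n J f \<Longrightarrow> x \<in> cube A n \<Longrightarrow> y \<in> cube A n \<Longrightarrow> agree_on J x y \<Longrightarrow> f x = f y"
  by (auto simp: depends_on_def)

lemma depends_on_mono: "depends_on A n J f \<Longrightarrow> J \<subseteq> K \<Longrightarrow> depends_on A n K f"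
  unfolding depends_on_def agree_on_def by (meson subsetD)

lemma depends_on_list_update:
  "depends_on A n J f \<Longrightarrow> i \<notin> J \<Longrightarrow> x \<in> cube A n \<Longrightarrow> a \<in> A \<Longrightarrow> f (x[i := a]) = f x"
  using depends_onD[of A n J f "x[i := a]" x] by (simp add: agree_on_list_update list_update_cube)

lemma coord_lary_iff_depends_on:
  assumes "0 < n"
  shows "coord_lary A n l f j \<longleftrightarrow> (\<exists>J\<subseteq>{..<n}. card J \<le> l \<and> depends_on A n J (\<lambda>x. f x ! j))"
proof
  assume "coord_lary A n l f j"
  then obtain ks h where ks: "length ks = l" "set ks \<subseteq> {..<n}"
    and h: "\<And>x. x \<in> cube A n \<Longrightarrow> f x ! j = h (map ((!) x) ks)"
    by (auto simp: coord_lary_def)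
  have "depends_on A n (set ks) (\<lambda>x. f x ! j)"
    unfolding depends_on_def agree_on_def
    by (intro ballI impI) (auto simp: h intro!: arg_cong[of _ _ h])
  then show "\<exists>J\<subseteq>{..<n}. card J \<le> l \<and> depends_on A n J (\<lambda>x. f x ! j)"
    using ks card_length[of ks] by (intro exI[of _ "set ks"]) auto
next
  assume "\<exists>J\<subseteq>{..<n}. card J \<le> l \<and> depends_on A n J (\<lambda>x. f x ! j)"
  then obtain J where J: "J \<subseteq> {..<n}" "card J \<le> l" and dep: "depends_on A n J (\<lambda>x. f x ! j)"
    by blast
  define ks where "ks = sorted_list_of_set J @ replicate (l - card J) 0"
  define select where "select = (\<lambda>x::'a list. map ((!) x) ks)"
  define h where "h zs = f (inv_into (cube A n) select zs) ! j" for zs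
  have "finite J"
    using J(1) finite_subset by blast
  then have ks: "length ks = l" "set ks \<subseteq> {..<n}" "J \<subseteq> set ks"
    using J assms by (auto simp: ks_def)
  have "f x ! j = h (select x)" if x: "x \<in> cube A n" for x
  proof -
    let ?y = "inv_into (cube A n) select (select x)"
    have "?y \<in> cube A n" "select ?y = select x"
      using x by (auto intro: inv_into_into f_inv_into_f)
    then have "agree_on J ?y x"
      using ks(3) by (auto simp: agree_on_def select_def)
    then show ?thesis
      using depends_onD[OF dep \<open>?y \<in> cube A n\<close> x] by (simp add: h_def)
  qed
  with ks(1,2) show "coord_lary A n l f j"
    unfolding coord_lary_def select_def by blast
qed

section \<open>Instructions as families of permutations of the alphabet\<close>

definition act_at :: "'a set \<Rightarrow> nat \<Rightarrow> nat \<Rightarrow> ('a list \<Rightarrow> 'a \<Rightarrow> 'a) \<Rightarrow> 'a list \<Rightarrow> 'a list" where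
  "act_at A n i s x = (if x \<in> cube A n then x[i := s x (x ! i)] else x)"

definition perm_family :: "'a set \<Rightarrow> nat \<Rightarrow> nat \<Rightarrow> ('a list \<Rightarrow> 'a \<Rightarrow> 'a) \<Rightarrow> bool" where
  "perm_family A n i s \<longleftrightarrow>
     i < n \<and> (\<forall>x\<in>cube A n. s x permutes A) \<and> depends_on A n ({..<n} - {i}) s"

lemma perm_familyD:
  assumes "perm_family A n i s"
  shows "i < n" "x \<in> cube A n \<Longrightarrow> s x permutes A" "depends_on A n ({..<n} - {i}) s"
  using assms by (auto simp: perm_family_def)

lemma perm_family_comp:
  "perm_family A n i s \<Longrightarrow> perm_family A n i t \<Longrightarrow> perm_family A n i (\<lambda>x. s x \<circ> t x)"
  unfolding perm_family_def depends_on_def by (metis permutes_compose)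

lemma perm_family_inv: "perm_family A n i s \<Longrightarrow> perm_family A n i (\<lambda>x. inv (s x))"
  unfolding perm_family_def depends_on_def by (metis permutes_inv)

lemma perm_family_const: "\<sigma> permutes A \<Longrightarrow> i < n \<Longrightarrow> perm_family A n i (\<lambda>_. \<sigma>)"
  by (simp add: perm_family_def depends_on_def)

lemma perm_family_list_update:
  "perm_family A n i s \<Longrightarrow> x \<in> cube A n \<Longrightarrow> a \<in> A \<Longrightarrow> s (x[i := a]) = s x"
  using depends_on_list_update[of A n "{..<n} - {i}" s i] by (simp add: perm_family_def)

lemma perm_family_nth:
  "perm_family A n i s \<Longrightarrow> x \<in> cube A n \<Longrightarrow> z \<in> cube A n \<Longrightarrow> s x (z ! i) \<in> A"
  using perm_familyD[of A n i s] by (simp add: permutes_in_image nth_cube)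

lemma act_at_cong: "(\<And>x. x \<in> cube A n \<Longrightarrow> s x = t x) \<Longrightarrow> act_at A n i s = act_at A n i t"
  by (simp add: act_at_def fun_eq_iff)

lemma act_at_id: "act_at A n i (\<lambda>_. id) = id"
  by (simp add: act_at_def fun_eq_iff)

lemma act_at_cube: "perm_family A n i s \<Longrightarrow> x \<in> cube A n \<Longrightarrow> act_at A n i s x \<in> cube A n"
  by (simp add: act_at_def list_update_cube perm_family_nth)

lemma nth_act_at:
  "x \<in> cube A n \<Longrightarrow> i < n \<Longrightarrow> act_at A n i s x ! j = (if j = i then s x (x ! i) else x ! j)"
  by (simp add: act_at_def length_cube)

lemma act_at_comp:
  assumes "perm_family A n i s" "perm_family A n i t"
  shows "act_at A n i s \<circ> act_at A n i t = act_at A n i (\<lambda>x. s x \<circ> t x)"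
proof
  fix x
  show "(act_at A n i s \<circ> act_at A n i t) x = act_at A n i (\<lambda>x. s x \<circ> t x) x"
    using assms perm_familyD(1)[OF assms(1)]
    by (simp add: act_at_def list_update_cube perm_family_nth perm_family_list_update length_cube)
qed

lemma act_at_inverse:
  assumes "perm_family A n i s"
  shows "act_at A n i (\<lambda>x. inv (s x)) \<circ> act_at A n i s = id"
    and "act_at A n i s \<circ> act_at A n i (\<lambda>x. inv (s x)) = id"
proof -
  have "act_at A n i (\<lambda>x. inv (s x) \<circ> s x) = id" "act_at A n i (\<lambda>x. s x \<circ> inv (s x)) = id"
    using permutes_inverses[OF perm_familyD(2)[OF assms]] by (simp_all add: act_at_def fun_eq_iff)
  then show "act_at A n i (\<lambda>x. inv (s x)) \<circ> act_at A n i s = id"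
    and "act_at A n i s \<circ> act_at A n i (\<lambda>x. inv (s x)) = id"
    using assms by (simp_all add: act_at_comp perm_family_inv)
qed

lemma inv_act_at: "perm_family A n i s \<Longrightarrow> inv (act_at A n i s) = act_at A n i (\<lambda>x. inv (s x))"
  by (intro inv_unique_comp act_at_inverse)

lemma act_at_permutes:
  assumes "perm_family A n i s"
  shows "act_at A n i s permutes cube A n"
proof (rule bij_imp_permutes)
  show "bij_betw (act_at A n i s) (cube A n) (cube A n)"
    using assms act_at_inverse[OF assms]
    by (intro bij_betw_byWitness[of _ "act_at A n i (\<lambda>x. inv (s x))"])
      (auto simp: fun_eq_iff intro: act_at_cube perm_family_inv)
qed (simp add: act_at_def)

lemma act_at_commutator:
  assumes "perm_family A n i s" "perm_family A n i t"
  shows "act_at A n i s \<circ> act_at A n i t \<circ> inv (act_at A n i s) \<circ> inv (act_at A n i t)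
    = act_at A n i (\<lambda>x. s x \<circ> t x \<circ> inv (s x) \<circ> inv (t x))"
  using assms by (simp add: inv_act_at act_at_comp perm_family_comp perm_family_inv)

lemma act_at_comp_other:
  assumes s: "perm_family A n i s" and t: "perm_family A n k t"
    and "i \<noteq> k" and indep: "depends_on A n ({..<n} - {i}) t"
  shows "act_at A n i s \<circ> act_at A n k t = act_at A n k t \<circ> act_at A n i (\<lambda>x. s (act_at A n k t x))"
proof
  fix x
  show "(act_at A n i s \<circ> act_at A n k t) x
    = (act_at A n k t \<circ> act_at A n i (\<lambda>x. s (act_at A n k t x))) x"
  proof (cases "x \<in> cube A n")
    case x: True
    define y where "y = x[k := t x (x ! k)]"
    define a where "a = s y (x ! i)"
    have "y \<in> cube A n"
      using x t by (simp add: y_def list_update_cube perm_family_nth)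
    then have "a \<in> A"
      using perm_family_nth[OF s _ x] by (simp add: a_def)
    then have "t (x[i := a]) = t x"
      using depends_on_list_update[OF indep _ x] by simp
    with x \<open>y \<in> cube A n\<close> \<open>a \<in> A\<close> \<open>i \<noteq> k\<close> show ?thesis
      by (simp add: act_at_def list_update_cube list_update_swap y_def a_def)
  qed (simp add: act_at_def)
qed

lemma perm_family_comp_other:
  assumes s: "perm_family A n i s" and t: "perm_family A n k t"
    and "i \<noteq> k" and indep: "depends_on A n ({..<n} - {i}) t"
  shows "perm_family A n i (\<lambda>x. s (act_at A n k t x))"
proof -
  have "s (act_at A n k t x) = s (act_at A n k t y)"
    if xy: "x \<in> cube A n" "y \<in> cube A n" and agree: "agree_on ({..<n} - {i}) x y" for x y
  proof (rule depends_onD[OF perm_familyD(3)[OF s] act_at_cube[OF t xy(1)] act_at_cube[OF t xy(2)]])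
    show "agree_on ({..<n} - {i}) (act_at A n k t x) (act_at A n k t y)"
      using agree depends_onD[OF indep xy agree] xy perm_familyD(1)[OF t] \<open>i \<noteq> k\<close>
      by (simp add: agree_on_def nth_act_at)
  qed
  then show ?thesis
    using perm_familyD(1,2)[OF s] act_at_cube[OF t]
    unfolding perm_family_def depends_on_def by blast
qed

lemma act_at_involution_commutator:
  assumes s: "perm_family A n i s" and t: "perm_family A n k t"
    and "i \<noteq> k" and indep: "depends_on A n ({..<n} - {i}) t"
    and involution: "act_at A n k t \<circ> act_at A n k t = id"
  shows "act_at A n i s \<circ> act_at A n k t \<circ> act_at A n i s \<circ> act_at A n k t
    = act_at A n i (\<lambda>x. s x \<circ> s (act_at A n k t x))" (is "?u \<circ> ?w \<circ> ?u \<circ> ?w = _")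
proof -
  note other = s t \<open>i \<noteq> k\<close> indep
  let ?v = "act_at A n i (\<lambda>x. s (?w x))"
  have "?u \<circ> ?w \<circ> ?u \<circ> ?w = ?u \<circ> ?w \<circ> (?u \<circ> ?w)"
    by (simp only: comp_assoc)
  also have "\<dots> = ?u \<circ> (?w \<circ> ?w) \<circ> ?v"
    by (subst (2) act_at_comp_other[OF other]) (simp only: comp_assoc)
  also have "\<dots> = ?u \<circ> ?v"
    by (simp only: involution comp_id)
  also have "\<dots> = act_at A n i (\<lambda>x. s x \<circ> s (?w x))"
    using act_at_comp[OF s perm_family_comp_other[OF other]] .
  finally show ?thesis .
qed

lemma lary_instruction_act_at:
  assumes s: "perm_family A n i s" "depends_on A n J s" and J: "J \<subseteq> {..<n}" "card J < l"
  shows "lary_instruction A n l (act_at A n i s)"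
proof -
  have i: "i < n"
    using s(1) by (rule perm_familyD)
  have "finite J"
    using J(1) finite_subset by blast
  have "\<exists>K\<subseteq>{..<n}. card K \<le> l \<and> depends_on A n K (\<lambda>x. act_at A n i s x ! j)" if "j < n" for j
  proof (cases "j = i")
    case True
    have "act_at A n i s x ! i = act_at A n i s y ! i"
      if "x \<in> cube A n" "y \<in> cube A n" "agree_on (insert i J) x y" for x y
      using that depends_onD[OF s(2) that(1,2)] i by (simp add: nth_act_at agree_on_def)
    then have "depends_on A n (insert i J) (\<lambda>x. act_at A n i s x ! j)"
      unfolding depends_on_def True by blast
    moreover have "card (insert i J) \<le> l"
      using J(2) \<open>finite J\<close> by (simp add: card_insert_if)
    ultimately show ?thesis
      using i J(1) by (intro exI[of _ "insert i J"]) simp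
  next
    case False
    have "depends_on A n {j} (\<lambda>x. act_at A n i s x ! j)"
      using False i by (simp add: depends_on_def nth_act_at agree_on_def)
    then show ?thesis
      using that J(2) by (intro exI[of _ "{j}"]) simp
  qed
  moreover have "is_instruction A n (act_at A n i s)"
    unfolding is_instruction_def using act_at_permutes[OF s(1)] i
    by (intro conjI exI[of _ i]) (simp_all add: nth_act_at)
  ultimately show ?thesis
    using i by (simp add: lary_instruction_def coord_lary_iff_depends_on)
qed

definition action_at :: "'a set \<Rightarrow> nat \<Rightarrow> ('a list \<Rightarrow> 'a list) \<Rightarrow> 'a list \<Rightarrow> 'a \<Rightarrow> 'a" where
  "action_at A i f x = restrict_id (\<lambda>a. f (x[i := a]) ! i) A"

context
  fixes A :: "'a set" and n i :: nat and f
  assumes permutes_cube: "f permutes cube A n" and i: "i < n"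
    and fixes_other_coords: "\<And>x j. x \<in> cube A n \<Longrightarrow> j < n \<Longrightarrow> j \<noteq> i \<Longrightarrow> f x ! j = x ! j"
begin

lemma instruction_list_update:
  assumes x: "x \<in> cube A n" and "a \<in> A"
  shows "f (x[i := a]) = x[i := f (x[i := a]) ! i]" "f (x[i := a]) ! i \<in> A"
proof -
  have upd: "x[i := a] \<in> cube A n"
    using assms by (rule list_update_cube)
  then have image: "f (x[i := a]) \<in> cube A n"
    using permutes_in_image[OF permutes_cube] by simp
  then show mem: "f (x[i := a]) ! i \<in> A"
    using i by (rule nth_cube)
  show "f (x[i := a]) = x[i := f (x[i := a]) ! i]"
  proof (rule cube_eqI[OF image list_update_cube[OF x mem]])
    show "f (x[i := a]) ! j = x[i := f (x[i := a]) ! i] ! j" if "j < n" for j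
      using that x i fixes_other_coords[OF upd that] by (cases "j = i") (simp_all add: length_cube)
  qed
qed

lemma instruction_eq_act_at: "f = act_at A n i (action_at A i f)"
proof
  fix x
  show "f x = act_at A n i (action_at A i f) x"
  proof (cases "x \<in> cube A n")
    case True
    then show ?thesis
      using instruction_list_update(1)[OF True nth_cube[OF True i]] nth_cube[OF True i]
      by (simp add: act_at_def action_at_def)
  next
    case False
    then show ?thesis
      using permutes_cube by (simp add: act_at_def permutes_not_in)
  qed
qed

lemma perm_family_action_at:
  assumes "finite A"
  shows "perm_family A n i (action_at A i f)"
proof -
  have "action_at A i f x permutes A" if x: "x \<in> cube A n" for x
  proof -
    have "inj_on (\<lambda>a. f (x[i := a]) ! i) A"
      using instruction_list_update(1)[OF x] permutes_inj[OF permutes_cube]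
        list_update_cube_eq_iff[OF x i]
      by (intro inj_onI) (metis injD)
    then show ?thesis
      unfolding action_at_def using assms instruction_list_update(2)[OF x]
      by (intro permutes_restrict_id bij_betw_imageI endo_inj_surj) auto
  qed
  moreover have "x[i := a] = y[i := a]"
    if "x \<in> cube A n" "y \<in> cube A n" "agree_on ({..<n} - {i}) x y" for x y a
    using that agree_on_off_coord_iff[OF that(1,2) i] by auto
  ultimately show ?thesis
    using i by (simp add: perm_family_def depends_on_def action_at_def)
qed

end

lemma obtain_distinct_pair:
  assumes "2 \<le> card A"
  obtains a b where "a \<in> A" "b \<in> A" "a \<noteq> b"
proof -
  obtain B where "B \<subseteq> A" "card B = 2"
    using assms by (rule obtain_subset_with_card_n)
  then show ?thesis
    using that by (auto simp: card_2_iff)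
qed

lemma lary_instructionE:
  assumes f: "lary_instruction A n l f" and A: "finite A" "2 \<le> card A"
  obtains i s J where "perm_family A n i s" "depends_on A n J s"
    "J \<subseteq> {..<n} - {i}" "card J < l" "f = act_at A n i s"
proof -
  obtain i where i: "i < n" "\<And>x j. x \<in> cube A n \<Longrightarrow> j < n \<Longrightarrow> j \<noteq> i \<Longrightarrow> f x ! j = x ! j"
    and perm: "f permutes cube A n"
    using f by (auto simp: lary_instruction_def is_instruction_def)
  let ?s = "action_at A i f"
  have s: "perm_family A n i ?s"
    using perm_family_action_at[OF perm i A(1)] .
  obtain J where J: "J \<subseteq> {..<n}" "card J \<le> l" and dep: "depends_on A n J (\<lambda>x. f x ! i)"
    using f i(1) coord_lary_iff_depends_on[of n A l f i] by (auto simp: lary_instruction_def)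
  have "i \<in> J"
  proof (rule ccontr)
    assume "i \<notin> J"
    obtain a b where ab: "a \<in> A" "b \<in> A" "a \<noteq> b"
      using A(2) by (rule obtain_distinct_pair)
    have x: "replicate n a \<in> cube A n"
      using ab(1) by (rule replicate_cube)
    have "?s (replicate n a) a = ?s (replicate n a) b"
      using ab \<open>i \<notin> J\<close> depends_on_list_update[OF dep _ x] by (simp add: action_at_def)
    then show False
      using permutes_inj[OF perm_familyD(2)[OF s x]] ab(3) by (simp add: inj_eq)
  qed
  have "f (x[i := a]) ! i = f (y[i := a]) ! i"
    if "x \<in> cube A n" "y \<in> cube A n" "agree_on (J - {i}) x y" "a \<in> A" for x y a
    using that i(1) by (intro depends_onD[OF dep] list_update_cube)
      (auto simp: agree_on_def nth_list_update length_cube)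
  then have "depends_on A n (J - {i}) ?s"
    by (auto simp: depends_on_def action_at_def restrict_id_def)
  moreover have "card (J - {i}) < l"
    using J \<open>i \<in> J\<close> by (metis card_Diff1_less finite_lessThan finite_subset less_le_trans)
  ultimately show ?thesis
    using that[OF s, of "J - {i}"] J(1) instruction_eq_act_at[OF perm i] by blast
qed

section \<open>The groups generated by instructions\<close>

lemma perm_group_G: "finite A \<Longrightarrow> perm_group (cube A n) (G A n l)"
  unfolding G_def
  by (rule perm_group_gen_perm_group)
    (auto simp: finite_cube lary_instruction_def is_instruction_def)

lemma G_subset_SymC: "finite A \<Longrightarrow> G A n l \<subseteq> SymC A n"
  using perm_group.permutes[OF perm_group_G] by (auto simp: SymC_def)

lemma G_mono:
  assumes "l \<le> l'" "0 < n"
  shows "G A n l \<subseteq> G A n l'"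
proof -
  have "{f. lary_instruction A n l f} \<subseteq> {f. lary_instruction A n l' f}"
    unfolding lary_instruction_def coord_lary_iff_depends_on[OF assms(2)]
    using assms(1) by (blast intro: le_trans)
  then show ?thesis
    unfolding G_def by (rule gen_perm_group_mono)
qed

lemma act_at_mem_G:
  assumes "perm_family A n i s" "depends_on A n J s" "J \<subseteq> {..<n}" "card J < l"
  shows "act_at A n i s \<in> G A n l"
  unfolding G_def using lary_instruction_act_at[OF assms] by (simp add: gen_incl)

definition ctrl :: "'a set \<Rightarrow> nat \<Rightarrow> nat \<Rightarrow> nat set \<Rightarrow> 'a list \<Rightarrow> ('a \<Rightarrow> 'a) \<Rightarrow> 'a list \<Rightarrow> 'a list" where
  "ctrl A n i J y \<sigma> = act_at A n i (\<lambda>x. if agree_on J x y then \<sigma> else id)"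

lemma depends_on_agree_on: "depends_on A n J (\<lambda>x. if agree_on J x y then \<sigma> else id)"
  by (simp add: depends_on_def agree_on_def)

lemma perm_family_ctrl:
  assumes "\<sigma> permutes A" "i < n" "J \<subseteq> {..<n} - {i}"
  shows "perm_family A n i (\<lambda>x. if agree_on J x y then \<sigma> else id)"
  using assms depends_on_mono[OF depends_on_agree_on] by (simp add: perm_family_def)

lemma ctrl_mem_G:
  assumes "\<sigma> permutes A" "i < n" "J \<subseteq> {..<n} - {i}" "card J < l"
  shows "ctrl A n i J y \<sigma> \<in> G A n l"
  unfolding ctrl_def using assms
  by (intro act_at_mem_G[OF perm_family_ctrl depends_on_agree_on]) auto

lemma ctrl_apply:
  "x \<in> cube A n \<Longrightarrow> ctrl A n i J y \<sigma> x = (if agree_on J x y then x[i := \<sigma> (x ! i)] else x)"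
  by (simp add: ctrl_def act_at_def)

lemma ctrl_involution:
  assumes "\<sigma> permutes A" "i < n" "J \<subseteq> {..<n} - {i}" and involution: "\<sigma> \<circ> \<sigma> = id"
  shows "ctrl A n i J y \<sigma> \<circ> ctrl A n i J y \<sigma> = id"
proof -
  let ?s = "\<lambda>x. if agree_on J x y then \<sigma> else id"
  have "?s x \<circ> ?s x = id" for x
    using involution by simp
  then show ?thesis
    unfolding ctrl_def
      act_at_comp[OF perm_family_ctrl[OF assms(1-3)] perm_family_ctrl[OF assms(1-3)]]
    by (simp only: act_at_id)
qed

lemma ctrl_commutator:
  assumes "\<sigma> permutes A" "\<tau> permutes A" "i < n" "J \<subseteq> {..<n} - {i}" "K \<subseteq> {..<n} - {i}"
  shows "ctrl A n i K y \<tau> \<circ> ctrl A n i J y \<sigma> \<circ> inv (ctrl A n i K y \<tau>) \<circ> inv (ctrl A n i J y \<sigma>)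
    = ctrl A n i (K \<union> J) y (\<tau> \<circ> \<sigma> \<circ> inv \<tau> \<circ> inv \<sigma>)"
  unfolding ctrl_def
    act_at_commutator[OF perm_family_ctrl[OF assms(2,3,5)] perm_family_ctrl[OF assms(1,3,4)]]
  using permutes_inv_o[OF assms(1)] permutes_inv_o[OF assms(2)]
  by (intro act_at_cong) (auto simp: agree_on_def ball_Un fun.map_comp)

lemma inj_on_line: "x \<in> cube A n \<Longrightarrow> i < n \<Longrightarrow> inj_on (\<lambda>a. x[i := a]) B"
  by (simp add: inj_on_def list_update_cube_eq_iff)

lemma ctrl_all_others:
  assumes x: "x \<in> cube A n" and i: "i < n"
  shows "ctrl A n i ({..<n} - {i}) x \<sigma> = map_permutation A (\<lambda>a. x[i := a]) \<sigma>"
proof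
  fix u
  show "ctrl A n i ({..<n} - {i}) x \<sigma> u = map_permutation A (\<lambda>a. x[i := a]) \<sigma> u"
  proof (cases "\<exists>a\<in>A. u = x[i := a]")
    case True
    then obtain a where a: "a \<in> A" "u = x[i := a]"
      by blast
    then have "ctrl A n i ({..<n} - {i}) x \<sigma> u = x[i := \<sigma> a]"
      using x i by (simp add: ctrl_apply list_update_cube agree_on_list_update length_cube)
    then show ?thesis
      using a map_permutation_apply[OF inj_on_line[OF x i] a(1), of \<sigma>] by simp
  next
    case False
    then have "u \<notin> cube A n \<or> \<not> agree_on ({..<n} - {i}) u x"
      using agree_on_off_coord_iff[OF x _ i] unfolding agree_on_def by metis
    then have "ctrl A n i ({..<n} - {i}) x \<sigma> u = u"
      by (auto simp: ctrl_def act_at_def)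
    moreover have "u \<notin> (\<lambda>a. x[i := a]) ` A"
      using False by blast
    ultimately show ?thesis
      by (simp add: map_permutation_def)
  qed
qed

lemma ctrl_all_others_transpose:
  assumes "x \<in> cube A n" "i < n" "a \<in> A" "b \<in> A"
  shows "ctrl A n i ({..<n} - {i}) x (transpose a b) = transpose (x[i := a]) (x[i := b])"
  unfolding ctrl_all_others[OF assms(1,2)]
  by (rule map_permutation_transpose[OF inj_on_line[OF assms(1,2)] assms(3,4)])

lemma ctrl_all_others_three_cycle:
  assumes "x \<in> cube A n" "i < n" "a \<in> A" "b \<in> A" "c \<in> A"
  shows "ctrl A n i ({..<n} - {i}) x (three_cycle a b c)
    = three_cycle (x[i := a]) (x[i := b]) (x[i := c])"
  using assms inj_on_line[OF assms(1,2), of A]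
  unfolding three_cycle_eq_transpositions ctrl_all_others[OF assms(1,2)]
  by (simp add: map_permutation_compose' map_permutation_transpose permutes_swap_id)

theorem G_eq_SymC_full:
  assumes "finite A"
  shows "G A n n = SymC A n"
proof
  show "G A n n \<subseteq> SymC A n"
    using assms by (rule G_subset_SymC)
  interpret perm_group "cube A n" "G A n n"
    using assms by (rule perm_group_G)
  have "transpose x y \<in> G A n n" if "x \<in> cube A n" "y \<in> cube A n" for x y
  proof (rule cube_connected[OF reflp_transpose_mem transp_transpose_mem that])
    fix z i
    assume z: "z \<in> cube A n" and i: "i < n"
    let ?t = "ctrl A n i ({..<n} - {i}) z (transpose (z ! i) (y ! i))"
    have "?t = transpose z (z[i := y ! i])"
      using nth_cube[OF z i] nth_cube[OF that(2) i]
        ctrl_all_others_transpose[OF z i, of "z ! i" "y ! i"] by simp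
    moreover have "?t \<in> G A n n"
      using z i that(2) by (intro ctrl_mem_G permutes_swap_id nth_cube) auto
    ultimately show "transpose z (z[i := y ! i]) \<in> G A n n"
      by simp
  qed
  then show "SymC A n \<subseteq> G A n n"
    using all_mem_if_transpositions by (auto simp: SymC_def)
qed

section \<open>Three-cycles over an alphabet with at least three letters\<close>

lemma ctrl_three_cycle_mem_G2:
  assumes "finite A" and abc: "distinct [a, b, c]" "{a, b, c} \<subseteq> A"
    and i: "i < n" and J: "J \<subseteq> {..<n} - {i}"
  shows "ctrl A n i J y (three_cycle a b c) \<in> G A n 2"
proof -
  interpret perm_group "cube A n" "G A n 2"
    using \<open>finite A\<close> by (rule perm_group_G)
  have perms: "three_cycle a b c permutes A" "transpose a b permutes A"
    using abc by (simp_all add: three_cycle_permutes permutes_swap_id)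
  have "finite J"
    using J finite_subset by blast
  then show ?thesis
    using J
  proof (induction J)
    case empty
    then show ?case
      using i perms by (intro ctrl_mem_G) auto
  next
    case (insert j J)
    let ?t = "ctrl A n i {j} y (transpose a b)" and ?c = "ctrl A n i J y (three_cycle a b c)"
    have "?t \<in> G A n 2"
      using insert.prems i perms by (intro ctrl_mem_G) auto
    then have "?t \<circ> ?c \<circ> inv ?t \<circ> inv ?c \<in> G A n 2"
      using insert by (intro commutator_mem) auto
    moreover have "?t \<circ> ?c \<circ> inv ?t \<circ> inv ?c = ctrl A n i ({j} \<union> J) y (three_cycle a b c)"
      using insert.prems i perms commutator_transpose_three_cycle[OF abc(1)]
      by (subst ctrl_commutator) auto
    ultimately show ?case
      by simp
  qed
qed

theorem linked_G2:
  assumes "finite A" "card A \<ge> 3" and xy: "x \<in> cube A n" "y \<in> cube A n"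
  shows "perm_group.linked (G A n 2) x y"
proof -
  interpret perm_group "cube A n" "G A n 2"
    using \<open>finite A\<close> by (rule perm_group_G)
  show ?thesis
  proof (rule cube_connected[OF reflp_linked transp_linked xy])
    fix z i
    assume z: "z \<in> cube A n" and i: "i < n" and neq: "z ! i \<noteq> y ! i"
    have "card {z ! i, y ! i} < card A"
      using neq assms(2) by simp
    then obtain c where "c \<in> A" "c \<notin> {z ! i, y ! i}"
      by (metis card_mono finite.emptyI finite.insertI linorder_not_less subsetI)
    then have abc: "distinct [z ! i, y ! i, c]" "{z ! i, y ! i, c} \<subseteq> A"
      using neq z xy(2) i by (auto simp: nth_cube)
    have "ctrl A n i ({..<n} - {i}) z (three_cycle (z ! i) (y ! i) c) \<in> G A n 2"
      using assms(1) abc i by (intro ctrl_three_cycle_mem_G2) auto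
    moreover have "ctrl A n i ({..<n} - {i}) z (three_cycle (z ! i) (y ! i) c)
        = three_cycle z (z[i := y ! i]) (z[i := c])"
      using abc by (subst ctrl_all_others_three_cycle[OF z i]) auto
    moreover have "distinct [z, z[i := y ! i], z[i := c]]"
      using abc(1) list_update_cube_eq_iff[OF z i, of "z ! i"]
        list_update_cube_eq_iff[OF z i, of "y ! i"] by auto
    ultimately show "linked z (z[i := y ! i])"
      unfolding linked_def by metis
  qed
qed

section \<open>Three-cycles over the binary alphabet\<close>

lemma toggle_commutator:
  fixes a0 a1 :: 'a
  defines "A \<equiv> {a0, a1}" and "\<tau> \<equiv> transpose a0 a1"
  assumes "a0 \<noteq> a1" and ijk: "i < n" "j < n" "k < n" "distinct [i, j, k]"
    and J: "J \<subseteq> {..<n} - {i, k}" and y: "y \<in> cube A n"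
  defines "u \<equiv> ctrl A n i {j, k} y \<tau>" and "w \<equiv> ctrl A n k J y \<tau>"
  shows "u \<circ> w \<circ> u \<circ> w = ctrl A n i (insert j J) y \<tau>"
proof -
  let ?s = "\<lambda>x. if agree_on {j, k} x y then \<tau> else id"
    and ?t = "\<lambda>x. if agree_on J x y then \<tau> else id"
  have "\<tau> permutes A"
    by (simp add: A_def \<tau>_def permutes_swap_id)
  then have s: "perm_family A n i ?s" and t: "perm_family A n k ?t"
    using ijk J by (auto intro!: perm_family_ctrl)
  have indep: "depends_on A n ({..<n} - {i}) ?t"
    using J by (intro depends_on_mono[OF depends_on_agree_on]) auto
  have "\<tau> \<circ> \<tau> = id"
    by (simp add: \<tau>_def)
  then have "w \<circ> w = id"
    unfolding w_def using \<open>\<tau> permutes A\<close> ijk(3) J by (intro ctrl_involution) auto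
  then have "u \<circ> w \<circ> u \<circ> w = act_at A n i (\<lambda>x. ?s x \<circ> ?s (w x))"
    unfolding u_def w_def ctrl_def using ijk(4)
    by (intro act_at_involution_commutator s t indep) auto
  (* If the controls J hold, w toggles x ! k, so exactly one of x and w x meets the control on k;
     otherwise w x = x and the two factors cancel. *)
  also have "\<dots> = ctrl A n i (insert j J) y \<tau>"
    unfolding ctrl_def
  proof (rule act_at_cong)
    fix x
    assume x: "x \<in> cube A n"
    have "x ! k = a0 \<or> x ! k = a1" "y ! k = a0 \<or> y ! k = a1"
      using nth_cube[OF x \<open>k < n\<close>] nth_cube[OF y \<open>k < n\<close>] by (simp_all add: A_def)
    then have "\<tau> (x ! k) = y ! k \<longleftrightarrow> x ! k \<noteq> y ! k"
      using \<open>a0 \<noteq> a1\<close> unfolding \<tau>_def by (elim disjE) simp_all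
    moreover have "w x ! j = x ! j" "w x ! k = (if agree_on J x y then \<tau> (x ! k) else x ! k)"
      using x ijk by (simp_all add: w_def ctrl_def nth_act_at)
    ultimately show "?s x \<circ> ?s (w x) = (if agree_on (insert j J) x y then \<tau> else id)"
      using \<open>\<tau> \<circ> \<tau> = id\<close> by (auto simp: agree_on_def)
  qed
  finally show ?thesis .
qed

lemma ctrl_toggle_mem_G3:
  assumes "a0 \<noteq> a1" and ik: "i < n" "k < n" "i \<noteq> k" and J: "J \<subseteq> {..<n} - {i, k}"
    and y: "y \<in> cube {a0, a1} n"
  shows "ctrl {a0, a1} n i J y (transpose a0 a1) \<in> G {a0, a1} n 3"
proof -
  interpret perm_group "cube {a0, a1} n" "G {a0, a1} n 3"
    by (rule perm_group_G) simp
  have \<tau>: "transpose a0 a1 permutes {a0, a1}"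
    by (simp add: permutes_swap_id)
  have "finite J"
    using J finite_subset by blast
  then show ?thesis
    using J ik
  proof (induction J arbitrary: i k)
    case empty
    then show ?case
      using \<tau> by (intro ctrl_mem_G) auto
  next
    case (insert j J)
    let ?u = "ctrl {a0, a1} n i {j, k} y (transpose a0 a1)"
      and ?w = "ctrl {a0, a1} n k J y (transpose a0 a1)"
    have "card {j, k} < 3"
      using insert.prems by simp
    then have "?u \<in> G {a0, a1} n 3"
      using insert.prems \<tau> by (intro ctrl_mem_G) auto
    moreover have "?w \<in> G {a0, a1} n 3"
      using insert.prems by (intro insert.IH[of k i]) auto
    ultimately have "?u \<circ> ?w \<circ> ?u \<circ> ?w \<in> G {a0, a1} n 3"
      by (simp add: comp_mem)
    moreover have "?u \<circ> ?w \<circ> ?u \<circ> ?w = ctrl {a0, a1} n i (insert j J) y (transpose a0 a1)"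
      using insert.prems assms(1) y by (intro toggle_commutator) auto
    ultimately show ?case
      by simp
  qed
qed

lemma ctrl_toggle_moves_iff:
  assumes "a0 \<noteq> a1" "i < n"
  shows "ctrl {a0, a1} n i J y (transpose a0 a1) x \<noteq> x \<longleftrightarrow> x \<in> cube {a0, a1} n \<and> agree_on J x y"
proof (cases "x \<in> cube {a0, a1} n")
  case True
  have "transpose a0 a1 (x ! i) \<noteq> x ! i"
    using nth_cube[OF True \<open>i < n\<close>] \<open>a0 \<noteq> a1\<close> by auto
  then have "x[i := transpose a0 a1 (x ! i)] \<noteq> x"
    using list_update_cube_eq_iff[OF True \<open>i < n\<close>, of _ "x ! i"] by simp
  then show ?thesis
    using True by (simp add: ctrl_apply)
qed (simp add: ctrl_def act_at_def)

lemma ctrl_toggles_single_common_moved_point: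
  fixes a0 a1 :: 'a
  assumes "a0 \<noteq> a1" and ijkm: "i < n" "k < n" "{i, j} \<inter> {k, m} = {}" and z: "z \<in> cube {a0, a1} n"
  defines "f \<equiv> ctrl {a0, a1} n i ({..<n} - {i, j}) z (transpose a0 a1)"
    and "g \<equiv> ctrl {a0, a1} n k ({..<n} - {k, m}) z (transpose a0 a1)"
  shows "f x \<noteq> x \<and> g x \<noteq> x \<longleftrightarrow> x = z"
proof -
  have "f x \<noteq> x \<and> g x \<noteq> x \<longleftrightarrow>
      x \<in> cube {a0, a1} n \<and> agree_on ({..<n} - {i, j}) x z \<and> agree_on ({..<n} - {k, m}) x z"
    unfolding f_def g_def using ctrl_toggle_moves_iff[OF assms(1)] ijkm(1,2) by blast
  also have "\<dots> \<longleftrightarrow> x \<in> cube {a0, a1} n \<and> agree_on {..<n} x z"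
    using ijkm(3) by (auto simp: agree_on_def)
  also have "\<dots> \<longleftrightarrow> x = z"
    using z by (auto simp: agree_on_def intro: cube_eqI)
  finally show ?thesis .
qed

theorem linked_G3:
  assumes "a0 \<noteq> a1" "n \<ge> 4" and xy: "x \<in> cube {a0, a1} n" "y \<in> cube {a0, a1} n"
  shows "perm_group.linked (G {a0, a1} n 3) x y"
proof -
  let ?A = "{a0, a1}" and ?\<tau> = "transpose a0 a1"
  interpret perm_group "cube ?A n" "G ?A n 3"
    by (rule perm_group_G) simp
  show ?thesis
  proof (rule cube_connected[OF reflp_linked transp_linked xy])
    fix z i
    assume z: "z \<in> cube ?A n" and i: "i < n" and neq: "z ! i \<noteq> y ! i"
    have "card ({..<n} - {i}) \<ge> 3"
      using assms(2) i by simp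
    then obtain S where "S \<subseteq> {..<n} - {i}" "card S = 3"
      by (meson obtain_subset_with_card_n)
    then obtain j k m where jkm: "j < n" "k < n" "m < n" "distinct [i, j, k, m]"
      by (auto simp: card_3_iff)
    let ?f = "ctrl ?A n i ({..<n} - {i, j}) z ?\<tau>" and ?g = "ctrl ?A n k ({..<n} - {k, m}) z ?\<tau>"
    have mem: "?f \<in> G ?A n 3" "?g \<in> G ?A n 3"
      using jkm i z assms(1)
      by (auto intro: ctrl_toggle_mem_G3[of _ _ i n j] ctrl_toggle_mem_G3[of _ _ k n m])
    have common: "?f v \<noteq> v \<and> ?g v \<noteq> v \<longleftrightarrow> v = z" for v
      using jkm(4) by (intro ctrl_toggles_single_common_moved_point assms(1) i jkm(2) z) auto
    have "?\<tau> (z ! i) = y ! i"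
      using nth_cube[OF z i] nth_cube[OF xy(2) i] neq by auto
    then have "?f z = z[i := y ! i]"
      using z by (simp add: ctrl_apply agree_on_def)
    moreover note commutator_eq_three_cycle[OF bij[OF mem(1)] bij[OF mem(2)] common]
      and distinct_images_of_common_moved_point[OF bij[OF mem(1)] bij[OF mem(2)] common]
    ultimately show "linked z (z[i := y ! i])"
      using commutator_mem[OF mem] unfolding linked_def by metis
  qed
qed

section \<open>Parity of instructions\<close>

definition slice :: "nat \<Rightarrow> 'a set \<Rightarrow> ('a list \<Rightarrow> 'a \<Rightarrow> 'a) \<Rightarrow> 'a list \<Rightarrow> 'a \<Rightarrow> 'a" where
  "slice k B s x = (if x ! k \<in> B then s x else id)"

context
  fixes A :: "'a set" and n i k :: nat and s
  assumes finite_A: "finite A" and s: "perm_family A n i s"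
    and k: "k < n" "k \<noteq> i" and indep: "depends_on A n ({..<n} - {i, k}) s"
begin

lemma perm_family_slice: "perm_family A n i (slice k B s)"
proof -
  have "slice k B s x = slice k B s y"
    if "x \<in> cube A n" "y \<in> cube A n" "agree_on ({..<n} - {i}) x y" for x y
    using depends_onD[OF perm_familyD(3)[OF s] that] that(3) k by (simp add: slice_def agree_on_def)
  then show ?thesis
    using perm_familyD(1,2)[OF s] unfolding perm_family_def depends_on_def by (simp add: slice_def)
qed

lemma permutation_slice: "permutation (act_at A n i (slice k B s))"
  using act_at_permutes[OF perm_family_slice] permutes_imp_permutation[OF finite_cube[OF finite_A]]
  by blast

lemma evenperm_slice_singleton:
  assumes "a \<in> A" "b \<in> A"
  shows "evenperm (act_at A n i (slice k {b} s)) \<longleftrightarrow> evenperm (act_at A n i (slice k {a} s))"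
proof -
  let ?\<psi> = "act_at A n k (\<lambda>_. transpose a b)"
  have \<psi>: "perm_family A n k (\<lambda>_. transpose a b)"
    using assms k(1) by (intro perm_family_const permutes_swap_id)
  then have "permutation ?\<psi>"
    using act_at_permutes permutes_imp_permutation[OF finite_cube[OF finite_A]] by blast
  have "slice k {b} s (?\<psi> x) = slice k {a} s x" if x: "x \<in> cube A n" for x
  proof -
    have "agree_on ({..<n} - {i, k}) (?\<psi> x) x"
      using x k(1) by (simp add: agree_on_def nth_act_at)
    then have "s (?\<psi> x) = s x"
      using depends_onD[OF indep act_at_cube[OF \<psi> x] x] by simp
    moreover have "?\<psi> x ! k = b \<longleftrightarrow> x ! k = a"
      using x k(1) by (auto simp: nth_act_at transpose_eq_iff)
    ultimately show ?thesis
      by (simp add: slice_def)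
  qed
  then have "act_at A n i (\<lambda>x. slice k {b} s (?\<psi> x)) = act_at A n i (slice k {a} s)"
    by (rule act_at_cong)
  then have "act_at A n i (slice k {b} s) \<circ> ?\<psi> = ?\<psi> \<circ> act_at A n i (slice k {a} s)"
    using act_at_comp_other[OF perm_family_slice \<psi>, of "{b}"] k(2) by (simp add: depends_on_def)
  then have "evenperm (act_at A n i (slice k {b} s) \<circ> ?\<psi>)
      = evenperm (?\<psi> \<circ> act_at A n i (slice k {a} s))"
    by simp
  then show ?thesis
    using \<open>permutation ?\<psi>\<close> permutation_slice by (auto simp: evenperm_comp)
qed

lemma evenperm_slice:
  assumes "a \<in> A" "B \<subseteq> A"
  shows "evenperm (act_at A n i (slice k B s))
    \<longleftrightarrow> even (card B) \<or> evenperm (act_at A n i (slice k {a} s))"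
  using finite_subset[OF assms(2) finite_A] assms(2)
proof (induction B)
  case empty
  have "slice k {} s = (\<lambda>_. id)"
    by (simp add: slice_def fun_eq_iff)
  then have "act_at A n i (slice k {} s) = id"
    by (simp only: act_at_id)
  then show ?case
    by simp
next
  case (insert b B)
  have "slice k (insert b B) s = (\<lambda>x. slice k {b} s x \<circ> slice k B s x)"
    using insert.hyps by (auto simp: slice_def fun_eq_iff)
  then have split: "act_at A n i (slice k (insert b B) s)
      = act_at A n i (slice k {b} s) \<circ> act_at A n i (slice k B s)"
    by (simp add: act_at_comp perm_family_slice)
  show ?case
    unfolding split evenperm_comp[OF permutation_slice permutation_slice]
    using insert evenperm_slice_singleton[OF assms(1), of b] by auto
qed

theorem evenperm_act_at_iff_slice:
  assumes "a \<in> A"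
  shows "evenperm (act_at A n i s) \<longleftrightarrow> even (card A) \<or> evenperm (act_at A n i (slice k {a} s))"
proof -
  have "act_at A n i s = act_at A n i (slice k A s)"
    using k(1) by (intro act_at_cong) (simp add: slice_def nth_cube)
  then show ?thesis
    using evenperm_slice[OF assms order_refl] by simp
qed

end

lemma perm_group_AltC:
  assumes "finite A"
  shows "perm_group (cube A n) (AltC A n)"
proof -
  have perm: "permutation f" if "f permutes cube A n" for f
    using that assms by (auto intro: permutes_imp_permutation finite_cube)
  show ?thesis
  proof
    show "f \<circ> g \<in> AltC A n" if "f \<in> AltC A n" "g \<in> AltC A n" for f g
      using that unfolding AltC_def
      by (simp only: mem_Collect_eq perm evenperm_comp permutes_compose)
    show "inv f \<in> AltC A n" if "f \<in> AltC A n" for f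
      using that unfolding AltC_def by (simp only: mem_Collect_eq perm evenperm_inv permutes_inv)
  qed (simp_all add: AltC_def assms finite_cube)
qed

lemma lary_instruction_mem_AltC:
  assumes A: "finite A" "even (card A)" "card A \<ge> 2" and "l < n" and f: "lary_instruction A n l f"
  shows "f \<in> AltC A n"
proof -
  obtain i s J where s: "perm_family A n i s" "depends_on A n J s" and f_eq: "f = act_at A n i s"
    and J: "J \<subseteq> {..<n} - {i}" "card J < l"
    using lary_instructionE[OF f A(1,3)] by blast
  have "card J < card ({..<n} - {i})"
    using J(2) \<open>l < n\<close> perm_familyD(1)[OF s(1)] by simp
  then have "J \<noteq> {..<n} - {i}"
    by blast
  then obtain k where k: "k < n" "k \<noteq> i" "k \<notin> J"
    using J(1) by blast
  have "depends_on A n ({..<n} - {i, k}) s"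
    using s(2) J(1) k by (elim depends_on_mono) auto
  moreover obtain a where "a \<in> A"
    using A(3) by fastforce
  ultimately have "evenperm f"
    using evenperm_act_at_iff_slice[OF A(1) s(1) k(1,2)] A(2) f_eq by blast
  then show ?thesis
    using act_at_permutes[OF s(1)] f_eq by (simp add: AltC_def)
qed

theorem G_subset_AltC:
  assumes "finite A" "even (card A)" "card A \<ge> 2" "l < n"
  shows "G A n l \<subseteq> AltC A n"
  unfolding G_def using lary_instruction_mem_AltC[OF assms]
  by (intro gen_perm_group_subset[OF perm_group_AltC[OF assms(1)]]) blast

lemma evenperm_ctrl_insert:
  assumes "finite A" "odd (card A)" "\<sigma> permutes A" "y \<in> cube A n" "i < n"
    and "insert k J \<subseteq> {..<n} - {i}" "k \<notin> J"
  shows "evenperm (ctrl A n i (insert k J) y \<sigma>) \<longleftrightarrow> evenperm (ctrl A n i J y \<sigma>)"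
proof -
  let ?s = "\<lambda>x. if agree_on J x y then \<sigma> else id"
  have "depends_on A n ({..<n} - {i, k}) ?s"
    using assms(6,7) by (intro depends_on_mono[OF depends_on_agree_on]) auto
  then have "evenperm (act_at A n i ?s) \<longleftrightarrow> evenperm (act_at A n i (slice k {y ! k} ?s))"
    using assms evenperm_act_at_iff_slice[of A n i ?s k "y ! k"]
    by (simp add: perm_family_ctrl nth_cube)
  moreover have "slice k {y ! k} ?s = (\<lambda>x. if agree_on (insert k J) x y then \<sigma> else id)"
    by (auto simp: slice_def agree_on_def fun_eq_iff)
  ultimately show ?thesis
    by (simp add: ctrl_def)
qed

theorem evenperm_ctrl_iff:
  assumes "finite A" "odd (card A)" "\<sigma> permutes A" "y \<in> cube A n" "i < n" and J: "J \<subseteq> {..<n} - {i}"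
  shows "evenperm (ctrl A n i J y \<sigma>) \<longleftrightarrow> evenperm \<sigma>"
proof -
  have no_control: "evenperm (ctrl A n i K y \<sigma>) \<longleftrightarrow> evenperm (ctrl A n i {} y \<sigma>)"
    if "K \<subseteq> {..<n} - {i}" for K
  proof -
    have "finite K"
      using that finite_subset by blast
    then show ?thesis
      using that
    proof (induction K)
      case (insert k K)
      then show ?case
        using evenperm_ctrl_insert[OF assms(1-5)] by simp
    qed simp
  qed
  have "evenperm (ctrl A n i J y \<sigma>) \<longleftrightarrow> evenperm (ctrl A n i ({..<n} - {i}) y \<sigma>)"
    using no_control[OF J] no_control[OF order_refl] by simp
  also have "\<dots> \<longleftrightarrow> evenperm \<sigma>"
    using assms by (simp add: ctrl_all_others evenperm_map_permutation[OF inj_on_line])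
  finally show ?thesis .
qed

lemma odd_mem_G:
  assumes A: "finite A" "odd (card A)" "card A \<ge> 2" and "0 < n" "0 < l"
  obtains g where "g \<in> G A n l" "\<not> evenperm g"
proof -
  obtain a b where ab: "a \<in> A" "b \<in> A" "a \<noteq> b"
    using A(3) by (rule obtain_distinct_pair)
  then have transpose: "transpose a b permutes A"
    by (simp add: permutes_swap_id)
  let ?g = "ctrl A n 0 {} (replicate n a) (transpose a b)"
  have "?g \<in> G A n l"
    using transpose assms(4,5) by (intro ctrl_mem_G) auto
  moreover have "\<not> evenperm ?g"
    using evenperm_ctrl_iff[OF A(1,2) transpose replicate_cube[OF ab(1)] assms(4)] ab(3)
    by (simp add: evenperm_swap)
  ultimately show ?thesis
    using that by blast
qed

section \<open>Symmetric and alternating groups as instruction groups\<close>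

lemma G_eq_AltC:
  assumes "finite A" "even (card A)" "card A \<ge> 2" "m \<le> l" "l < n"
    and "\<And>x y. x \<in> cube A n \<Longrightarrow> y \<in> cube A n \<Longrightarrow> perm_group.linked (G A n m) x y"
  shows "G A n l = AltC A n"
proof
  show "G A n l \<subseteq> AltC A n"
    using assms(1-3,5) by (rule G_subset_AltC)
  have "AltC A n \<subseteq> G A n m"
    using perm_group.even_mem_if_linked[OF perm_group_G[OF assms(1)] assms(6)]
    by (auto simp: AltC_def)
  then show "AltC A n \<subseteq> G A n l"
    using G_mono[of m l n A] assms(4,5) by simp
qed

theorem G_eq_AltC_binary:
  assumes "card A = 2" "n \<ge> 4" "3 \<le> l" "l < n"
  shows "G A n l = AltC A n"
proof -
  obtain a0 a1 where A: "A = {a0, a1}" "a0 \<noteq> a1"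
    using assms(1) by (auto simp: card_2_iff)
  show ?thesis
    using assms linked_G3[OF A(2)] unfolding A(1) by (intro G_eq_AltC[of _ 3]) auto
qed

theorem G_eq_AltC_even:
  assumes "finite A" "card A \<ge> 3" "even (card A)" "2 \<le> l" "l < n"
  shows "G A n l = AltC A n"
  using assms linked_G2[OF assms(1,2)] by (intro G_eq_AltC[of _ 2]) auto

theorem G_eq_SymC_odd:
  assumes "finite A" "card A \<ge> 3" "odd (card A)" "2 \<le> l" "0 < n"
  shows "G A n l = SymC A n"
proof
  show "G A n l \<subseteq> SymC A n"
    using assms(1) by (rule G_subset_SymC)
  obtain g where "g \<in> G A n 2" "\<not> evenperm g"
    using odd_mem_G[OF assms(1,3) _ assms(5), of 2] assms(2) by auto
  then have "SymC A n \<subseteq> G A n 2"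
    using perm_group.all_mem_if_linked_and_odd[OF perm_group_G linked_G2] assms(1,2)
    by (auto simp: SymC_def)
  then show "SymC A n \<subseteq> G A n l"
    using G_mono[OF assms(4,5), of A] by blast
qed

section \<open>Affine permutations over the binary alphabet\<close>

text \<open>On a two-element alphabet \<open>xor3\<close> is \<open>a + b + c\<close> for either identification with \<open>GF(2)\<close>.\<close>

definition xor3 :: "'a \<Rightarrow> 'a \<Rightarrow> 'a \<Rightarrow> 'a" where
  "xor3 a b c = (if a = b then c else if a = c then b else a)"

definition vxor3 :: "nat \<Rightarrow> 'a list \<Rightarrow> 'a list \<Rightarrow> 'a list \<Rightarrow> 'a list" where
  "vxor3 n x y z = map (\<lambda>i. xor3 (x ! i) (y ! i) (z ! i)) [0..<n]"

definition preserves_vxor3 :: "'a set \<Rightarrow> nat \<Rightarrow> ('a list \<Rightarrow> 'a list) \<Rightarrow> bool" where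
  "preserves_vxor3 A n f \<longleftrightarrow>
     (\<forall>x\<in>cube A n. \<forall>y\<in>cube A n. \<forall>z\<in>cube A n. f (vxor3 n x y z) = vxor3 n (f x) (f y) (f z))"

definition xor3_perms :: "'a set \<Rightarrow> nat \<Rightarrow> ('a list \<Rightarrow> 'a list) set" where
  "xor3_perms A n = {f. f permutes cube A n \<and> preserves_vxor3 A n f}"

lemma xor3_mem: "a \<in> A \<Longrightarrow> b \<in> A \<Longrightarrow> c \<in> A \<Longrightarrow> xor3 a b c \<in> A"
  by (simp add: xor3_def)

lemma nth_vxor3: "i < n \<Longrightarrow> vxor3 n x y z ! i = xor3 (x ! i) (y ! i) (z ! i)"
  by (simp add: vxor3_def)

lemma vxor3_cube:
  "x \<in> cube A n \<Longrightarrow> y \<in> cube A n \<Longrightarrow> z \<in> cube A n \<Longrightarrow> vxor3 n x y z \<in> cube A n"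
  by (rule cubeI) (simp_all add: vxor3_def xor3_mem nth_cube)

lemma preserves_vxor3D:
  "preserves_vxor3 A n f \<Longrightarrow> x \<in> cube A n \<Longrightarrow> y \<in> cube A n \<Longrightarrow> z \<in> cube A n \<Longrightarrow>
    f (vxor3 n x y z) = vxor3 n (f x) (f y) (f z)"
  by (simp add: preserves_vxor3_def)

lemma preserves_vxor3I:
  assumes cube: "\<And>x. x \<in> cube A n \<Longrightarrow> f x \<in> cube A n"
    and nth: "\<And>x y z i. x \<in> cube A n \<Longrightarrow> y \<in> cube A n \<Longrightarrow> z \<in> cube A n \<Longrightarrow> i < n \<Longrightarrow>
      f (vxor3 n x y z) ! i = xor3 (f x ! i) (f y ! i) (f z ! i)"
  shows "preserves_vxor3 A n f"
  unfolding preserves_vxor3_def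
proof (intro ballI)
  fix x y z
  assume xyz: "x \<in> cube A n" "y \<in> cube A n" "z \<in> cube A n"
  show "f (vxor3 n x y z) = vxor3 n (f x) (f y) (f z)"
  proof (rule cube_eqI)
    show "f (vxor3 n x y z) \<in> cube A n" "vxor3 n (f x) (f y) (f z) \<in> cube A n"
      using xyz by (simp_all add: cube vxor3_cube)
    show "f (vxor3 n x y z) ! i = vxor3 n (f x) (f y) (f z) ! i" if "i < n" for i
      using that xyz by (simp add: nth nth_vxor3)
  qed
qed

lemma perm_group_xor3_perms:
  assumes "finite A"
  shows "perm_group (cube A n) (xor3_perms A n)"
proof
  show "f \<circ> g \<in> xor3_perms A n" if "f \<in> xor3_perms A n" "g \<in> xor3_perms A n" for f g
    using that unfolding xor3_perms_def preserves_vxor3_def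
    by (auto simp: permutes_compose permutes_in_image)
  show "inv f \<in> xor3_perms A n" if "f \<in> xor3_perms A n" for f
  proof -
    have perm: "f permutes cube A n" and f: "preserves_vxor3 A n f"
      using that by (simp_all add: xor3_perms_def)
    have "inv f (vxor3 n x y z) = vxor3 n (inv f x) (inv f y) (inv f z)"
      if "x \<in> cube A n" "y \<in> cube A n" "z \<in> cube A n" for x y z
    proof -
      have "f (vxor3 n (inv f x) (inv f y) (inv f z)) = vxor3 n x y z"
        using preserves_vxor3D[OF f] that permutes_in_image[OF permutes_inv[OF perm]]
        by (simp add: permutes_inverses[OF perm])
      then show ?thesis
        using permutes_inv_eq[OF perm] by metis
    qed
    then show ?thesis
      using permutes_inv[OF perm] by (simp add: xor3_perms_def preserves_vxor3_def)
  qed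
qed (use assms in \<open>auto simp: xor3_perms_def preserves_vxor3_def finite_cube\<close>)

locale binary_cube =
  fixes a0 a1 :: 'a and n :: nat
  assumes a0_neq_a1: "a0 \<noteq> a1"
begin

abbreviation A :: "'a set" where
  "A \<equiv> {a0, a1}"

lemma nth_binary_cube: "x \<in> cube A n \<Longrightarrow> i < n \<Longrightarrow> x ! i = a0 \<or> x ! i = a1"
  using nth_cube by fastforce

lemma xor3_medial:
  assumes "a \<in> A" "a' \<in> A" "a'' \<in> A" "b \<in> A" "b' \<in> A" "b'' \<in> A"
  shows "xor3 (xor3 a a' a'') (xor3 b b' b'') a0
    = xor3 (xor3 a b a0) (xor3 a' b' a0) (xor3 a'' b'' a0)"
  using assms by (elim insertE emptyE) (simp_all add: xor3_def a0_neq_a1 a0_neq_a1[symmetric])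

lemma permutation_eq_xor3:
  assumes "\<sigma> permutes A" "c \<in> A"
  shows "\<sigma> c = xor3 c (\<sigma> a0) a0"
  using assms a0_neq_a1 unfolding permutes_doubleton_iff
  by (elim disjE insertE emptyE) (simp_all add: xor3_def)

lemma xor3_if_depends_on_single_coord:
  assumes g: "depends_on A n {k} g" and "k < n"
    and x: "x \<in> cube A n" and y: "y \<in> cube A n" and z: "z \<in> cube A n"
  shows "g (vxor3 n x y z) = xor3 (g x) (g y) (g z)"
proof -
  have g_eq: "g u = g v" if "u \<in> cube A n" "v \<in> cube A n" "u ! k = v ! k" for u v
    using depends_onD[OF g that(1,2)] that(3) by (simp add: agree_on_def)
  note v = vxor3_cube[OF x y z] and v_k = nth_vxor3[OF \<open>k < n\<close>, of x y z]
  consider "x ! k = y ! k" | "x ! k = z ! k" | "y ! k = z ! k"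
    using nth_binary_cube[OF x \<open>k < n\<close>] nth_binary_cube[OF y \<open>k < n\<close>] nth_binary_cube[OF z \<open>k < n\<close>]
    by metis
  then show ?thesis
  proof cases
    assume "x ! k = y ! k"
    then show ?thesis
      using g_eq[OF v z] g_eq[OF x y] v_k by (simp add: xor3_def)
  next
    assume "x ! k = z ! k"
    then show ?thesis
      using g_eq[OF v y] g_eq[OF x z] v_k by (auto simp: xor3_def)
  next
    assume "y ! k = z ! k"
    then show ?thesis
      using g_eq[OF v x] g_eq[OF y z] v_k by (auto simp: xor3_def)
  qed
qed

lemma perm_family_xor3:
  assumes s: "perm_family A n i s" "depends_on A n {k} s" and "k < n"
    and x: "x \<in> cube A n" and y: "y \<in> cube A n" and z: "z \<in> cube A n"
  shows "s (vxor3 n x y z) (xor3 (x ! i) (y ! i) (z ! i))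
    = xor3 (s x (x ! i)) (s y (y ! i)) (s z (z ! i))"
proof -
  have i: "i < n"
    using s(1) by (rule perm_familyD)
  note mem = nth_cube[OF x i] nth_cube[OF y i] nth_cube[OF z i]
  define g where "g x = s x a0" for x
  have s_eq: "s x c = xor3 c (g x) a0" if "x \<in> cube A n" "c \<in> A" for x c
    using permutation_eq_xor3[OF perm_familyD(2)[OF s(1)]] that unfolding g_def .
  have g_mem: "g x \<in> A" if "x \<in> cube A n" for x
    using permutes_in_image[OF perm_familyD(2)[OF s(1) that], of a0] by (simp add: g_def)
  have "depends_on A n {k} g"
    using s(2) unfolding depends_on_def g_def by metis
  then have g: "g (vxor3 n x y z) = xor3 (g x) (g y) (g z)"
    using \<open>k < n\<close> x y z by (rule xor3_if_depends_on_single_coord)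
  have "s (vxor3 n x y z) (xor3 (x ! i) (y ! i) (z ! i))
      = xor3 (xor3 (x ! i) (y ! i) (z ! i)) (xor3 (g x) (g y) (g z)) a0"
    using s_eq[OF vxor3_cube[OF x y z] xor3_mem[OF mem]] g by simp
  also have "\<dots> = xor3 (s x (x ! i)) (s y (y ! i)) (s z (z ! i))"
    using s_eq[OF x mem(1)] s_eq[OF y mem(2)] s_eq[OF z mem(3)]
      xor3_medial[OF mem g_mem[OF x] g_mem[OF y] g_mem[OF z]] by simp
  finally show ?thesis .
qed

lemma binary_instruction_mem_xor3_perms:
  assumes "lary_instruction A n 2 f"
  shows "f \<in> xor3_perms A n"
proof -
  obtain i s J where s: "perm_family A n i s" "depends_on A n J s" and f: "f = act_at A n i s"
    and J: "J \<subseteq> {..<n} - {i}" "card J < 2"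
    using lary_instructionE[OF assms] a0_neq_a1 by (metis card_2_iff order_refl finite.intros)
  have i: "i < n"
    using s(1) by (rule perm_familyD)
  have "J = {} \<or> (\<exists>k. J = {k})"
    using J finite_subset[OF J(1)] by (auto simp: less_2_cases_iff card_1_singleton_iff)
  then obtain k where k: "k < n" "J \<subseteq> {k}"
    using J(1) i by auto
  have dep: "depends_on A n {k} s"
    using s(2) k(2) by (rule depends_on_mono)
  have "preserves_vxor3 A n f"
  proof (rule preserves_vxor3I)
    show "f (vxor3 n x y z) ! j = xor3 (f x ! j) (f y ! j) (f z ! j)"
      if "x \<in> cube A n" "y \<in> cube A n" "z \<in> cube A n" "j < n" for x y z j
      using that i perm_family_xor3[OF s(1) dep k(1) that(1-3)]
      by (simp add: f nth_act_at nth_vxor3 vxor3_cube)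
  qed (simp add: f act_at_cube s(1))
  then show ?thesis
    using act_at_permutes[OF s(1)] by (simp add: xor3_perms_def f)
qed

lemma G2_subset_xor3_perms: "G A n 2 \<subseteq> xor3_perms A n"
  unfolding G_def using binary_instruction_mem_xor3_perms
  by (intro gen_perm_group_subset[OF perm_group_xor3_perms]) auto

definition origin :: "'a list" where
  "origin = replicate n a0"

definition unit :: "nat \<Rightarrow> 'a list" where
  "unit k = origin[k := a1]"

lemma origin_cube: "origin \<in> cube A n"
  by (simp add: origin_def replicate_cube)

lemma unit_cube: "unit k \<in> cube A n"
  by (simp add: unit_def origin_cube list_update_cube)

lemma nth_origin: "i < n \<Longrightarrow> origin ! i = a0"
  by (simp add: origin_def)

lemma nth_unit: "i < n \<Longrightarrow> unit k ! i = (if i = k then a1 else a0)"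
  by (simp add: unit_def origin_def nth_list_update)

lemma vxor3_unit_origin:
  assumes x: "x \<in> cube A n" and k: "k < n" "x ! k = a1"
  shows "vxor3 n (x[k := a0]) (unit k) origin = x"
proof (rule cube_eqI[OF _ x])
  show "vxor3 n (x[k := a0]) (unit k) origin \<in> cube A n"
    using x by (intro vxor3_cube list_update_cube unit_cube origin_cube) auto
  show "vxor3 n (x[k := a0]) (unit k) origin ! i = x ! i" if "i < n" for i
    using that k length_cube[OF x]
    by (auto simp: nth_vxor3 nth_unit nth_origin nth_list_update xor3_def)
qed

lemma preserves_vxor3_eqI:
  assumes f: "preserves_vxor3 A n f" and g: "preserves_vxor3 A n g"
    and origin: "f origin = g origin" and x: "x \<in> cube A n"
    and unit: "\<And>k. k < n \<Longrightarrow> x ! k \<noteq> a0 \<Longrightarrow> f (unit k) = g (unit k)"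
  shows "f x = g x"
proof -
  let ?R = "\<lambda>u v. f v = g v \<longrightarrow> f u = g u"
  have "?R x origin"
  proof (rule cube_connected[OF _ _ x origin_cube, of ?R])
    fix z i
    assume z: "z \<in> cube A n" and i: "i < n" "z ! i \<noteq> origin ! i"
      and origin_coords: "\<And>j. x ! j = origin ! j \<Longrightarrow> z ! j = origin ! j"
    have "f (unit i) = g (unit i)"
      using i origin_coords[of i] unit nth_origin by auto
    moreover have "z ! i = a1"
      using nth_binary_cube[OF z i(1)] i nth_origin by simp
    then have "z = vxor3 n (z[i := a0]) (unit i) origin"
      using vxor3_unit_origin[OF z i(1)] by simp
    moreover have "z[i := a0] \<in> cube A n"
      using z by (simp add: list_update_cube)
    ultimately show "?R z (z[i := origin ! i])"
      using preserves_vxor3D[OF f _ unit_cube origin_cube]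
        preserves_vxor3D[OF g _ unit_cube origin_cube] origin nth_origin[OF i(1)] by metis
  qed (auto simp: reflp_def transp_def)
  then show ?thesis
    using origin by blast
qed

interpretation G2: perm_group "cube A n" "G A n 2"
  by (rule perm_group_G) simp

interpretation xor3_perms: perm_group "cube A n" "xor3_perms A n"
  by (rule perm_group_xor3_perms) simp

lemma G2_transitive:
  assumes "x \<in> cube A n" "y \<in> cube A n"
  shows "G2.same_orbit x y"
proof (rule cube_connected[OF G2.reflp_same_orbit G2.transp_same_orbit assms])
  fix z i
  assume z: "z \<in> cube A n" and i: "i < n"
  let ?h = "ctrl A n i {} z (transpose (z ! i) (y ! i))"
  have "?h \<in> G A n 2"
    using z i assms(2) by (intro ctrl_mem_G permutes_swap_id nth_cube) auto
  moreover have "?h z = z[i := y ! i]"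
    using z by (simp add: ctrl_apply agree_on_def)
  ultimately show "G2.same_orbit z (z[i := y ! i])"
    unfolding G2.same_orbit_def by blast
qed

definition add_coord :: "nat \<Rightarrow> nat \<Rightarrow> 'a list \<Rightarrow> 'a list" where
  "add_coord i j = ctrl A n i {j} (replicate n a1) (transpose a0 a1)"

lemma add_coord_apply:
  "x \<in> cube A n \<Longrightarrow> j < n \<Longrightarrow>
    add_coord i j x = (if x ! j = a1 then x[i := transpose a0 a1 (x ! i)] else x)"
  by (simp add: add_coord_def ctrl_apply agree_on_def)

definition frame_stabilizer :: "nat \<Rightarrow> ('a list \<Rightarrow> 'a list) set" where
  "frame_stabilizer k = G2.pointwise_stabilizer (insert origin (unit ` {..<k}))"

interpretation frame_stabilizer: perm_group "cube A n" "frame_stabilizer k" for k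
  unfolding frame_stabilizer_def by (rule G2.perm_group_pointwise_stabilizer)

lemma add_coord_mem_frame_stabilizer:
  assumes "i < n" "j < n" "i \<noteq> j" "k \<le> j"
  shows "add_coord i j \<in> frame_stabilizer k"
proof -
  have "add_coord i j \<in> G A n 2"
    unfolding add_coord_def using assms by (intro ctrl_mem_G permutes_swap_id) auto
  moreover have "add_coord i j (unit m) = unit m" if "m < k" for m
    using assms that a0_neq_a1 by (simp add: add_coord_apply unit_cube nth_unit)
  moreover have "add_coord i j origin = origin"
    using assms a0_neq_a1 by (simp add: add_coord_apply origin_cube nth_origin)
  ultimately show ?thesis
    by (auto simp: frame_stabilizer_def G2.pointwise_stabilizer_def)
qed

lemma frame_stabilizer_clear_column:
  assumes x: "x \<in> cube A n" and k: "k < n" "x ! k = a1"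
  shows "frame_stabilizer.same_orbit k x (unit k)"
proof (rule cube_connected[OF frame_stabilizer.reflp_same_orbit frame_stabilizer.transp_same_orbit
      x unit_cube])
  fix z i
  assume z: "z \<in> cube A n" and i: "i < n" "z ! i \<noteq> unit k ! i"
    and unit_coords: "\<And>j. x ! j = unit k ! j \<Longrightarrow> z ! j = unit k ! j"
  have "z ! k = a1" "i \<noteq> k"
    using unit_coords[of k] k i by (auto simp: nth_unit)
  then have "add_coord i k z = z[i := unit k ! i]"
    using z k(1) i nth_binary_cube[OF z i(1)] by (auto simp: add_coord_apply nth_unit)
  then show "frame_stabilizer.same_orbit k z (z[i := unit k ! i])"
    using add_coord_mem_frame_stabilizer[OF i(1) k(1) \<open>i \<noteq> k\<close> order_refl]
    unfolding frame_stabilizer.same_orbit_def by blast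
qed

lemma frame_stabilizer_move_to_unit:
  assumes x: "x \<in> cube A n" and j: "k \<le> j" "j < n" "x ! j = a1"
  obtains h where "h \<in> frame_stabilizer k" "h x = unit k"
proof -
  have "k < n"
    using j by simp
  obtain h where h: "h \<in> frame_stabilizer k" "h x ! k = a1"
  proof (cases "x ! k = a1")
    case True
    then show ?thesis
      using that[of id] frame_stabilizer.id_mem by simp
  next
    case False
    then have "x ! k = a0" "j \<noteq> k"
      using nth_binary_cube[OF x \<open>k < n\<close>] j(3) by auto
    then show ?thesis
      using that[OF add_coord_mem_frame_stabilizer[of k j k]] j \<open>k < n\<close> x
      by (simp add: add_coord_apply length_cube)
  qed
  have "h x \<in> cube A n"
    using frame_stabilizer.mem_X_iff[OF h(1)] x by simp
  then obtain h' where "h' \<in> frame_stabilizer k" "h' (h x) = unit k"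
    using frame_stabilizer_clear_column[OF _ \<open>k < n\<close> h(2)]
    unfolding frame_stabilizer.same_orbit_def by blast
  then show ?thesis
    using that[of "h' \<circ> h"] h(1) frame_stabilizer.comp_mem by simp
qed

lemma xor3_perm_image_of_next_unit:
  assumes f: "f \<in> xor3_perms A n" and origin: "f origin = origin"
    and units: "\<And>m. m < k \<Longrightarrow> f (unit m) = unit m" and "k < n"
  obtains j where "k \<le> j" "j < n" "f (unit k) ! j = a1"
proof (rule ccontr)
  assume "\<not> thesis"
  then have none: "f (unit k) ! j \<noteq> a1" if "k \<le> j" "j < n" for j
    using that \<open>\<And>j. k \<le> j \<Longrightarrow> j < n \<Longrightarrow> f (unit k) ! j = a1 \<Longrightarrow> thesis\<close> by blast
  have image: "f (unit k) \<in> cube A n"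
    using xor3_perms.mem_X_iff[OF f] unit_cube by simp
  have "f (f (unit k)) = id (f (unit k))"
  proof (rule preserves_vxor3_eqI[OF _ _ _ image])
    show "f (unit m) = id (unit m)" if "m < n" "f (unit k) ! m \<noteq> a0" for m
      using that none[of m] nth_binary_cube[OF image, of m] units[of m] by fastforce
  qed (use f origin in \<open>simp_all add: xor3_perms_def preserves_vxor3_def\<close>)
  then have "f (unit k) = unit k"
    using xor3_perms.bij[OF f] by (simp add: bij_is_inj inj_eq)
  then show False
    using none[of k] \<open>k < n\<close> by (simp add: nth_unit)
qed

lemma gaussian_elimination:
  assumes f: "f \<in> xor3_perms A n" and "k \<le> n"
  obtains h where "h \<in> G A n 2" "h (f origin) = origin" "\<And>m. m < k \<Longrightarrow> h (f (unit m)) = unit m"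
  using \<open>k \<le> n\<close>
proof (induction k arbitrary: thesis)
  case 0
  have "f origin \<in> cube A n"
    using xor3_perms.mem_X_iff[OF f] origin_cube by simp
  then show ?case
    using G2_transitive[OF _ origin_cube] 0 unfolding G2.same_orbit_def by blast
next
  case (Suc k)
  then obtain h where h: "h \<in> G A n 2" "h (f origin) = origin"
    "\<And>m. m < k \<Longrightarrow> h (f (unit m)) = unit m"
    by auto
  have hf: "h \<circ> f \<in> xor3_perms A n"
    using h(1) f G2_subset_xor3_perms by (intro xor3_perms.comp_mem) auto
  then have "(h \<circ> f) (unit k) \<in> cube A n"
    using xor3_perms.mem_X_iff unit_cube by blast
  moreover obtain j where "k \<le> j" "j < n" "(h \<circ> f) (unit k) ! j = a1"
    using xor3_perm_image_of_next_unit[OF hf, of k] h(2,3) Suc.prems(2) by auto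
  ultimately obtain h' where h': "h' \<in> frame_stabilizer k" "h' ((h \<circ> f) (unit k)) = unit k"
    by (rule frame_stabilizer_move_to_unit)
  show ?case
  proof (rule Suc.prems(1))
    show "h' \<circ> h \<in> G A n 2"
      using h(1) h'(1) G2.comp_mem by (simp add: frame_stabilizer_def G2.pointwise_stabilizer_def)
    have h'_fixes: "h' origin = origin" "\<And>m. m < k \<Longrightarrow> h' (unit m) = unit m"
      using h'(1) by (simp_all add: frame_stabilizer_def G2.pointwise_stabilizer_def)
    show "(h' \<circ> h) (f origin) = origin"
      using h(2) h'_fixes(1) by simp
    show "(h' \<circ> h) (f (unit m)) = unit m" if "m < Suc k" for m
      using that h(3) h'(2) h'_fixes(2) by (cases "m = k") auto
  qed
qed

theorem xor3_perms_subset_G2: "xor3_perms A n \<subseteq> G A n 2"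
proof
  fix f
  assume f: "f \<in> xor3_perms A n"
  obtain h where h: "h \<in> G A n 2" "h (f origin) = origin" "\<And>m. m < n \<Longrightarrow> h (f (unit m)) = unit m"
    using gaussian_elimination[OF f order_refl] by blast
  have hf: "h \<circ> f \<in> xor3_perms A n"
    using h(1) f G2_subset_xor3_perms by (intro xor3_perms.comp_mem) auto
  have "(h \<circ> f) x = id x" for x
  proof (cases "x \<in> cube A n")
    case True
    then show ?thesis
      using hf h(2,3) preserves_vxor3_eqI[of "h \<circ> f" id x]
      by (simp add: xor3_perms_def preserves_vxor3_def)
  next
    case False
    then show ?thesis
      using permutes_not_in[OF xor3_perms.permutes[OF hf]] by simp
  qed
  then have "f = inv h"
    using G2.bij[OF h(1)] by (simp add: fun_eq_iff bij_inv_eq_iff)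
  then show "f \<in> G A n 2"
    using G2.inv_mem[OF h(1)] by simp
qed

lemma enc2_xor3:
  assumes "a \<in> A" "b \<in> A" "c \<in> A"
  shows "enc2 a1 (xor3 a b c) = enc2 a1 a + enc2 a1 b + enc2 a1 c"
  using assms a0_neq_a1 by (auto simp: xor3_def enc2_def)

lemma enc2_inj: "a \<in> A \<Longrightarrow> b \<in> A \<Longrightarrow> enc2 a1 a = enc2 a1 b \<Longrightarrow> a = b"
  using a0_neq_a1 by (auto simp: enc2_def split: if_splits)



lemma enc2_dec2: "enc2 a1 (dec2 a0 a1 b) = b"
  using a0_neq_a1 by (cases b) (auto simp: enc2_def dec2_def)

lemma dec2_mem: "dec2 a0 a1 b \<in> A"
  by (simp add: dec2_def)



(* The default simp set rewrites sums of bits to parities of cardinalities. *)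
declare add_bit_eq_xor [simp del] mult_bit_eq_and [simp del]

definition affine_map :: "(nat \<Rightarrow> nat \<Rightarrow> bit) \<Rightarrow> (nat \<Rightarrow> bit) \<Rightarrow> 'a list \<Rightarrow> 'a list" where
  "affine_map M b x = map (\<lambda>i. dec2 a0 a1 ((\<Sum>j<n. M i j * enc2 a1 (x ! j)) + b i)) [0..<n]"

lemma affine_map_cube: "affine_map M b x \<in> cube A n"
  using dec2_mem by (auto simp: cube_def affine_map_def)

lemma enc2_nth_affine_map:
  "i < n \<Longrightarrow> enc2 a1 (affine_map M b x ! i) = (\<Sum>j<n. M i j * enc2 a1 (x ! j)) + b i"
  by (simp add: affine_map_def enc2_dec2)

lemma mem_AffC_iff:
  "f \<in> AffC a0 a1 n \<longleftrightarrow>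
    f permutes cube A n \<and> (\<exists>M b. invertible2 n M \<and> (\<forall>x\<in>cube A n. f x = affine_map M b x))"
  by (simp add: AffC_def affine_map_def)

lemma preserves_vxor3_affine_map: "preserves_vxor3 A n (affine_map M b)"
proof (rule preserves_vxor3I)
  fix x y z i
  assume x: "x \<in> cube A n" and y: "y \<in> cube A n" and z: "z \<in> cube A n" and i: "i < n"
  let ?L = "\<lambda>x. \<Sum>j<n. M i j * enc2 a1 (x ! j)"
  note mem = affine_map_cube[THEN nth_cube, OF i]
  have "?L (vxor3 n x y z) = (\<Sum>j<n. M i j * (enc2 a1 (x ! j) + enc2 a1 (y ! j) + enc2 a1 (z ! j)))"
    using enc2_xor3[OF nth_cube[OF x] nth_cube[OF y] nth_cube[OF z]]
    by (intro sum.cong) (simp_all add: nth_vxor3)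
  also have "\<dots> = ?L x + ?L y + ?L z"
    by (simp add: distrib_left sum.distrib)
  finally have "enc2 a1 (affine_map M b (vxor3 n x y z) ! i) = ?L x + ?L y + ?L z + b i"
    using i by (simp add: enc2_nth_affine_map)
  also have "\<dots> = (?L x + b i) + (?L y + b i) + (?L z + b i)"
    by (cases "b i") (simp_all add: algebra_simps)
  also have "\<dots>
      = enc2 a1 (xor3 (affine_map M b x ! i) (affine_map M b y ! i) (affine_map M b z ! i))"
    using i by (simp add: enc2_xor3[OF mem mem mem] enc2_nth_affine_map)
  finally show "affine_map M b (vxor3 n x y z) ! i
      = xor3 (affine_map M b x ! i) (affine_map M b y ! i) (affine_map M b z ! i)"
    by (intro enc2_inj[OF mem xor3_mem[OF mem mem mem]])
qed (rule affine_map_cube)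

definition translation_part :: "('a list \<Rightarrow> 'a list) \<Rightarrow> nat \<Rightarrow> bit" where
  "translation_part f i = enc2 a1 (f origin ! i)"

definition linear_part :: "('a list \<Rightarrow> 'a list) \<Rightarrow> nat \<Rightarrow> nat \<Rightarrow> bit" where
  "linear_part f i j = enc2 a1 (f (unit j) ! i) + translation_part f i"

lemma xor3_perm_eq_affine_map:
  assumes f: "f \<in> xor3_perms A n" and x: "x \<in> cube A n"
  shows "f x = affine_map (linear_part f) (translation_part f) x"
proof (rule preserves_vxor3_eqI[OF _ preserves_vxor3_affine_map _ x])
  show "preserves_vxor3 A n f"
    using f by (simp add: xor3_perms_def)
  have f_cube: "f y \<in> cube A n" if "y \<in> cube A n" for y
    using xor3_perms.mem_X_iff[OF f] that by simp
  have affine_mapI: "f y = affine_map (linear_part f) (translation_part f) y"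
    if y: "y \<in> cube A n"
      and enc: "\<And>i. i < n \<Longrightarrow> enc2 a1 (f y ! i)
        = (\<Sum>j<n. linear_part f i j * enc2 a1 (y ! j)) + translation_part f i" for y
    using enc nth_cube[OF f_cube[OF y]] nth_cube[OF affine_map_cube]
    by (intro cube_eqI[OF f_cube[OF y] affine_map_cube] enc2_inj)
      (simp_all add: enc2_nth_affine_map)
  show "f origin = affine_map (linear_part f) (translation_part f) origin"
    using a0_neq_a1
    by (intro affine_mapI origin_cube) (simp add: nth_origin enc2_def translation_part_def)
  show "f (unit k) = affine_map (linear_part f) (translation_part f) (unit k)" if "k < n" for k
  proof (rule affine_mapI[OF unit_cube])
    fix i
    have "(\<Sum>j<n. linear_part f i j * enc2 a1 (unit k ! j)) = linear_part f i k"
      using that a0_neq_a1 by (simp add: nth_unit enc2_def if_distrib sum.delta cong: if_cong)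
    then show "enc2 a1 (f (unit k) ! i)
        = (\<Sum>j<n. linear_part f i j * enc2 a1 (unit k ! j)) + translation_part f i"
      by (cases "translation_part f i") (simp_all add: linear_part_def add.assoc)
  qed
qed

lemma enc2_xor3_perm:
  assumes "f \<in> xor3_perms A n" "x \<in> cube A n" "i < n"
  shows "enc2 a1 (f x ! i) = (\<Sum>j<n. linear_part f i j * enc2 a1 (x ! j)) + translation_part f i"
  using assms by (simp add: xor3_perm_eq_affine_map enc2_nth_affine_map)

lemma invertible2_linear_part:
  assumes f: "f \<in> xor3_perms A n"
  shows "invertible2 n (linear_part f)"
  unfolding invertible2_def
proof (intro exI[of _ "linear_part (inv f)"] allI impI)
  fix i k
  assume "i < n" "k < n"
  have inv_f: "inv f (f x) = x" for x
    using xor3_perms.bij[OF f] by (simp add: bij_is_inj)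
  let ?N = "linear_part (inv f)" and ?c = "translation_part (inv f)"
  let ?L = "\<lambda>x. \<Sum>j<n. ?N i j * enc2 a1 (f x ! j)"
  have enc: "enc2 a1 (x ! i) = ?L x + ?c i" if "x \<in> cube A n" for x
    using enc2_xor3_perm[OF xor3_perms.inv_mem[OF f], of "f x" i] that \<open>i < n\<close>
    by (simp only: inv_f xor3_perms.mem_X_iff[OF f])
  have "(\<Sum>j<n. ?N i j * linear_part f j k) = ?L (unit k) + ?L origin"
    by (simp add: linear_part_def[of f] translation_part_def[of f] distrib_left sum.distrib)
  also have "\<dots> = (?L (unit k) + ?c i) + (?L origin + ?c i)"
    by (cases "?c i") (simp_all add: algebra_simps)
  also have "\<dots> = enc2 a1 (unit k ! i) + enc2 a1 (origin ! i)"
    by (simp only: enc[OF unit_cube] enc[OF origin_cube])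
  also have "\<dots> = (if i = k then 1 else 0)"
    using \<open>i < n\<close> a0_neq_a1 by (simp add: nth_unit nth_origin enc2_def)
  finally show "(\<Sum>j<n. ?N i j * linear_part f j k) = (if i = k then 1 else 0)" .
qed

theorem xor3_perms_eq_AffC: "xor3_perms A n = AffC a0 a1 n"
proof
  show "xor3_perms A n \<subseteq> AffC a0 a1 n"
  proof
    show "f \<in> AffC a0 a1 n" if f: "f \<in> xor3_perms A n" for f
      unfolding mem_AffC_iff
      using xor3_perms.permutes[OF f] invertible2_linear_part[OF f] xor3_perm_eq_affine_map[OF f]
      by blast
  qed
  show "AffC a0 a1 n \<subseteq> xor3_perms A n"
  proof
    fix f
    assume "f \<in> AffC a0 a1 n"
    then obtain M b where perm: "f permutes cube A n"
      and f: "\<And>x. x \<in> cube A n \<Longrightarrow> f x = affine_map M b x"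
      unfolding mem_AffC_iff by blast
    have "preserves_vxor3 A n f"
      using preserves_vxor3D[OF preserves_vxor3_affine_map[of M b]]
      by (simp add: preserves_vxor3_def f vxor3_cube)
    then show "f \<in> xor3_perms A n"
      using perm by (simp add: xor3_perms_def)
  qed
qed

theorem G2_eq_AffC: "G A n 2 = AffC a0 a1 n"
  using G2_subset_xor3_perms xor3_perms_subset_G2 xor3_perms_eq_AffC by simp

end

theorem theorem2:
  fixes A :: "'a set" and n :: nat
  assumes "finite A" and "card A \<ge> 2" and "n \<ge> 2"
  shows "G A n n = SymC A n
    \<and> (card A = 2 \<longrightarrow> (\<forall>a0 a1. A = {a0, a1} \<and> a0 \<noteq> a1 \<longrightarrow> G A n 2 = AffC a0 a1 n))
    \<and> (card A = 2 \<and> n \<ge> 4 \<longrightarrow> G A n 3 = AltC A n \<and> G A n (n - 1) = AltC A n)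
    \<and> (n \<ge> 3 \<and> card A \<ge> 3 \<and> odd (card A) \<longrightarrow>
           G A n 2 = SymC A n \<and> G A n (n - 1) = SymC A n)
    \<and> (n \<ge> 3 \<and> card A \<ge> 4 \<and> even (card A) \<longrightarrow>
           G A n 2 = AltC A n \<and> G A n (n - 1) = AltC A n)"
proof (intro conjI impI allI)
  show "G A n n = SymC A n"
    using assms(1) by (rule G_eq_SymC_full)
  show "G A n 2 = AffC a0 a1 n" if "A = {a0, a1} \<and> a0 \<noteq> a1" for a0 a1
    using that binary_cube.G2_eq_AffC[of a0 a1 n] by (simp add: binary_cube_def)
  show "G A n 3 = AltC A n" "G A n (n - 1) = AltC A n" if "card A = 2 \<and> n \<ge> 4"
    using that G_eq_AltC_binary[of A n] by auto
  show "G A n 2 = SymC A n" "G A n (n - 1) = SymC A n" if "n \<ge> 3 \<and> card A \<ge> 3 \<and> odd (card A)"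
    using that G_eq_SymC_odd[OF assms(1)] by auto
  show "G A n 2 = AltC A n" "G A n (n - 1) = AltC A n" if "n \<ge> 3 \<and> card A \<ge> 4 \<and> even (card A)"
    using that G_eq_AltC_even[OF assms(1), of _ n] by auto
qed

end
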